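(* Let $N,Q\in\mathbb{N}$ with $Q\le N$, let $f:\mathbb{N}\to\mathbb{C}$ and let $g_Q:\mathbb{N}\to\mathbb{C}$ have Eratosthenes Transform $g_Q'$ vanishing outside $[1,Q]$. Put $\widehat{g_Q}(\ell)=\sum_{d\le Q,\ \ell\mid d} g_Q'(d)/d$ and $C_{f,g_Q}(N,a)=\sum_{n\le N}f(n)g_Q(n+a)$. First, the condition $\widehat{g_Q}=\mu^2\cdot\widehat{g_Q}$ holds if and only if $g_Q(a)=g_Q(\kappa(a))$ for all $a\in\mathbb{N}$. Assume moreover: (1) $\widehat{g_Q}=\mu^2\cdot \widehat{g_Q}$ (i.e. $\widehat{g_Q}$ is supported on square-free numbers); (2) $f$ is supported on primes: $f(n)=0$ unless $n$ is prime; (3) both $f$ and $g_Q$ satisfy the Ramanujan Conjecture. Then for all $a\in\mathbb{N}$, $$C_{f,g_Q}(N,a)=\mathcal{P}_{f,g_Q}(N,a)+\mathcal{S}_{f,g_Q}(N,a),$$ where $$\mathcal{P}_{f,g_Q}(N,a)=\sum_{q\le Q}\mu(q)\widehat{g_Q}(q)\sum_{m\mid q}\mu(m)\,m\sum_{\substack{p\le N\\ (p,m)=1\\ -p\equiv a\ (\mathrm{mod}\ m)}} f(p) =\sum_{q\le Q}\mu(q)\widehat{g_Q}(q)\sum_{m\mid q}\frac{\mu(m)\,m}{\varphi(m)}\sum_{\chi\ (\mathrm{mod}\ m)}\sum_{p\le N} f(p)\,\overline{\chi(-p)}\,\chi(a),$$ and $$\mathcal{S}_{f,g_Q}(N,a)=\sum_{p\mid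 a} f(p)\,p\sum_{q'\ge1}\mu(q')\widehat{g_Q}(pq')\sum_{\substack{m'\mid q'\\ \frac ap\equiv -1\ (\mathrm{mod}\ m')}}\mu(m')\,m',$$ and $\mathcal{S}_{f,g_Q}(N,a)=O_\varepsilon(N^\varepsilon a)$ for all $a\in\mathbb{N}$ and every $\varepsilon>0$.
   Context: $p$ always denotes a prime. $\mu$ is the Möbius function, $\varphi$ Euler's totient, and $\kappa(a)=\prod_{p\mid a}p$ the square-free kernel of $a$ ($\kappa(1)=1$). The Eratosthenes Transform of $h:\mathbb{N}\to\mathbb{C}$ is $h'(d)=\sum_{t\mid d}h(t)\mu(d/t)$. The inner sum $\sum_{\chi\ (\mathrm{mod}\ m)}$ runs over all $\varphi(m)$ Dirichlet characters modulo $m$. An arithmetic function $h$ satisfies the Ramanujan Conjecture if for every $\varepsilon>0$ there is $C(\varepsilon)$ with $|h(n)|\le C(\varepsilon)n^\varepsilon$ for all $n$. $O_\varepsilon$ denotes a bound with implied constant depending on $\varepsilon$. *)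

theory Defs
  imports "HOL-Analysis.Infinite_Sum" "HOL-Computational_Algebra.Squarefree"
    "HOL-Number_Theory.Cong" "HOL-Number_Theory.Totient"
begin

text \<open>
  Arithmetic functions are functions on \<^typ>\<open>nat\<close>, of which only the values at positive
  arguments matter.
\<close>

definition moebius_mu :: "nat \<Rightarrow> 'a :: comm_ring_1" where
  "moebius_mu n = (if squarefree n then (- 1) ^ card (prime_factors n) else 0)"

definition squarefree_kernel :: "nat \<Rightarrow> nat" where
  "squarefree_kernel a = \<Prod>(prime_factors a)"

definition eratosthenes :: "(nat \<Rightarrow> complex) \<Rightarrow> nat \<Rightarrow> complex" where
  "eratosthenes h d = (\<Sum>t | t dvd d. h t * moebius_mu (d div t))"

definition ramanujan_conjecture :: "(nat \<Rightarrow> complex) \<Rightarrow> bool" where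
  "ramanujan_conjecture h \<longleftrightarrow>
     (\<forall>\<epsilon>>0. \<exists>C. \<forall>n\<ge>1. norm (h n) \<le> C * real n powr \<epsilon>)"

text \<open>
  The Ramanujan Conjecture with a prescribed choice \<open>C \<epsilon>\<close> of its constants. It is needed to
  say that an implied constant depends on \<open>h\<close> only through these constants.
\<close>

definition ramanujan_bound :: "(real \<Rightarrow> real) \<Rightarrow> (nat \<Rightarrow> complex) \<Rightarrow> bool" where
  "ramanujan_bound C h \<longleftrightarrow> (\<forall>\<epsilon>>0. \<forall>n\<ge>1. norm (h n) \<le> C \<epsilon> * real n powr \<epsilon>)"

lemma ramanujan_conjecture_iff_bound: "ramanujan_conjecture h \<longleftrightarrow> (\<exists>C. ramanujan_bound C h)"
  unfolding ramanujan_conjecture_def ramanujan_bound_def by metis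

text \<open>Dirichlet characters are functions on the integers because they are evaluated at \<open>- p\<close>.\<close>

definition dirichlet_char :: "nat \<Rightarrow> (int \<Rightarrow> complex) \<Rightarrow> bool" where
  "dirichlet_char m \<chi> \<longleftrightarrow>
     (\<forall>x y. \<chi> (x * y) = \<chi> x * \<chi> y) \<and>
     (\<forall>x. \<chi> (x + int m) = \<chi> x) \<and>
     (\<forall>x. \<chi> x \<noteq> 0 \<longleftrightarrow> coprime x (int m))"

definition g_hat :: "nat \<Rightarrow> (nat \<Rightarrow> complex) \<Rightarrow> nat \<Rightarrow> complex" where
  "g_hat Q g l = (\<Sum>d | d \<in> {1..Q} \<and> l dvd d. eratosthenes g d / of_nat d)"

definition correlation :: "(nat \<Rightarrow> complex) \<Rightarrow> (nat \<Rightarrow> complex) \<Rightarrow> nat \<Rightarrow> nat \<Rightarrow> complex" where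
  "correlation f g N a = (\<Sum>n=1..N. f n * g (n + a))"

definition P_term ::
  "(nat \<Rightarrow> complex) \<Rightarrow> nat \<Rightarrow> (nat \<Rightarrow> complex) \<Rightarrow> nat \<Rightarrow> nat \<Rightarrow> complex" where
  "P_term f Q g N a =
     (\<Sum>q=1..Q. moebius_mu q * g_hat Q g q *
       (\<Sum>m | m dvd q. moebius_mu m * of_nat m *
         (\<Sum>p | prime p \<and> p \<le> N \<and> coprime p m \<and> [- int p = int a] (mod int m). f p)))"

definition P_term_chars ::
  "(nat \<Rightarrow> complex) \<Rightarrow> nat \<Rightarrow> (nat \<Rightarrow> complex) \<Rightarrow> nat \<Rightarrow> nat \<Rightarrow> complex" where
  "P_term_chars f Q g N a =
     (\<Sum>q=1..Q. moebius_mu q * g_hat Q g q *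
       (\<Sum>m | m dvd q. moebius_mu m * of_nat m / of_nat (totient m) *
         (\<Sum>\<chi> | dirichlet_char m \<chi>.
           \<Sum>p | prime p \<and> p \<le> N. f p * cnj (\<chi> (- int p)) * \<chi> (int a))))"

text \<open>
  The sum over \<open>q'\<close> has finite support, since \<^term>\<open>g_hat Q g (p * q')\<close> vanishes when
  \<open>p * q' > Q\<close>. The defining formula does not involve \<open>N\<close>.
\<close>

definition S_term :: "(nat \<Rightarrow> complex) \<Rightarrow> nat \<Rightarrow> (nat \<Rightarrow> complex) \<Rightarrow> nat \<Rightarrow> complex" where
  "S_term f Q g a =
     (\<Sum>p | prime p \<and> p dvd a. f p * of_nat p *
       (\<Sum>\<^sub>\<infinity>q'\<in>{1..}. moebius_mu q' * g_hat Q g (p * q') *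
         (\<Sum>m' | m' dvd q' \<and> [int (a div p) = - 1] (mod int m'). moebius_mu m' * of_nat m')))"

end

theory Submission
  imports Defs "HOL-Number_Theory.Residue_Primitive_Roots"
    "HOL-Analysis.Complex_Transcendental" "HOL-Analysis.Summation_Tests"
begin

text \<open>
  Applying Moebius inversion to \<open>m \<mapsto> m\<close> restricted to the divisors of \<open>n\<close> gives the Ramanujan
  expansion of \<open>g n\<close>, with coefficients \<^const>\<open>g_hat\<close>. At \<open>n = p + a\<close> a square-free modulus \<open>m\<close> is
  either coprime to \<open>p\<close> or a multiple of \<open>p\<close>: the former moduli make up \<^const>\<open>P_term\<close>; the latter
  force \<open>p dvd a\<close>, and pulling the factor \<open>p\<close> out of \<open>q\<close> and \<open>m\<close> yields \<^const>\<open>S_term\<close>. Only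
  square-free moduli carry weight, so the orthogonality of characters is needed for these
  alone, where a primitive root modulo a prime factor already separates residues. For the
  bound, the values \<open>g_hat Q g l\<close> are at most \<open>Q powr \<epsilon> / l\<close> up to a constant, and the sum over
  \<open>m'\<close> is controlled on average over \<open>q'\<close> by the number of divisors of \<open>a / p + 1\<close>, which is at
  most \<open>2 a / p\<close>.
\<close>

unbundle no vec_syntax \<comment> \<open>frees \<open>\<chi>\<close> for characters\<close>

section \<open>Moebius inversion\<close>

lemma moebius_mu_1 [simp]: "moebius_mu (Suc 0) = 1"
  by (simp add: moebius_mu_def)

lemma moebius_mu_mult_coprime:
  assumes "coprime m n"
  shows "moebius_mu (m * n) = moebius_mu m * (moebius_mu n :: 'a :: comm_ring_1)"
proof (cases "m = 0 \<or> n = 0")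
  case False
  have "prime_factors m \<inter> prime_factors n = {}"
    using assms by (metis coprime_def disjoint_iff in_prime_factors_iff not_prime_unit)
  then have "card (prime_factors (m * n)) = card (prime_factors m) + card (prime_factors n)"
    using False by (simp add: prime_factors_product card_Un_disjoint)
  moreover have "squarefree (m * n) \<longleftrightarrow> squarefree m \<and> squarefree n"
    using assms squarefree_mult_coprime squarefree_multD by metis
  ultimately show ?thesis
    by (simp add: moebius_mu_def power_add)
qed (auto simp: moebius_mu_def)

lemma moebius_mu_prime: "prime p \<Longrightarrow> moebius_mu p = (- 1 :: 'a :: comm_ring_1)"
  by (simp add: moebius_mu_def squarefree_prime prime_prime_factors)

lemma moebius_mu_not_squarefree: "\<not> squarefree n \<Longrightarrow> moebius_mu n = 0"
  by (simp add: moebius_mu_def)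

lemma moebius_mu_squared: "squarefree n \<Longrightarrow> (moebius_mu n)\<^sup>2 = (1 :: 'a :: comm_ring_1)"
  by (simp add: moebius_mu_def power_mult [symmetric] mult.commute)

lemma norm_moebius_mu: "norm (moebius_mu n :: complex) = (if squarefree n then 1 else 0)"
  by (simp add: moebius_mu_def norm_power)

lemma norm_moebius_mu_le: "norm (moebius_mu n :: complex) \<le> 1"
  by (simp add: norm_moebius_mu)

lemma squarefree_mult_imp_coprime: "squarefree (m * n :: nat) \<Longrightarrow> coprime m n"
  by (metis coprimeI mult_dvd_mono power2_eq_square squarefreeD)

text \<open>Writing \<open>q = m * k\<close>, square-freeness makes \<open>m\<close> and
  \<open>k\<close> coprime, so mu(q) mu(m) = mu(m)^2 mu(k) = mu(k). This trades a quotient for a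
  product in \<open>eratosthenes_squarefree\<close>.\<close>

lemma moebius_mu_div:
  assumes "squarefree q" "m dvd q"
  shows "moebius_mu (q div m) = moebius_mu q * (moebius_mu m :: 'a :: comm_ring_1)"
proof -
  from assms obtain k where q: "q = m * k" by blast
  with assms have "coprime m k" "squarefree m" "m \<noteq> 0"
    using squarefree_mult_imp_coprime squarefree_multD by (auto intro!: Nat.gr0I)
  then have "moebius_mu q * moebius_mu m = (moebius_mu m)\<^sup>2 * (moebius_mu k :: 'a)"
    unfolding q moebius_mu_mult_coprime[OF \<open>coprime m k\<close>] power2_eq_square
    by (simp only: mult_ac)
  with \<open>squarefree m\<close> \<open>m \<noteq> 0\<close> have "moebius_mu q * moebius_mu m = (moebius_mu k :: 'a)"
    by (simp add: moebius_mu_squared)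
  with \<open>m \<noteq> 0\<close> show ?thesis by (simp add: q)
qed

text \<open>Fix a prime \<open>p\<close> dividing \<open>n\<close>. Only square-free divisors
  contribute, and \<open>d\<close> and \<open>p * d\<close> pair those prime to \<open>p\<close>
  (\<open>S\<close>) with those divisible by \<open>p\<close> (\<open>T\<close>), with opposite
  signs.\<close>

lemma sum_moebius_mu_divisors:
  assumes "n > 0"
  shows "(\<Sum>d | d dvd n. moebius_mu d) = (if n = 1 then 1 else 0 :: 'a :: comm_ring_1)"
proof (cases "n = 1")
  case False
  then obtain p where p: "prime p" "p dvd n" using prime_factor_nat by blast
  define S where "S = {d. d dvd n \<and> squarefree d \<and> \<not> p dvd d}"
  define T where "T = {d. d dvd n \<and> squarefree d \<and> p dvd d}"
  have fin: "finite S" "finite T" "finite {d. d dvd n}"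
    using assms by (auto simp: S_def T_def)
  have "bij_betw ((*) p) S T"
  proof (rule bij_betw_byWitness[where f' = "\<lambda>d. d div p"])
    show "\<forall>d\<in>S. p * d div p = d" "\<forall>d\<in>T. p * (d div p) = d"
      using p by (auto simp: T_def)
    show "(*) p ` S \<subseteq> T"
      using p squarefree_prime[OF p(1)]
      by (auto simp: S_def T_def divides_mult prime_imp_coprime intro!: squarefree_mult_coprime)
    show "(\<lambda>d. d div p) ` T \<subseteq> S"
    proof (clarify)
      fix d assume "d \<in> T"
      then obtain k where k: "d = p * k" "squarefree (p * k)" "p * k dvd n"
        by (auto simp: T_def)
      have "coprime p k" using squarefree_mult_imp_coprime k(2) .
      then have "\<not> p dvd k" using p(1) by (metis coprime_absorb_left not_prime_unit)
      moreover have "squarefree k" using squarefree_multD(2)[OF k(2)] .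
      moreover have "k dvd n" using k(3) by (rule dvd_mult_right)
      ultimately show "d div p \<in> S" using k p by (auto simp: S_def)
    qed
  qed
  then have "(\<Sum>d\<in>T. moebius_mu d) = (\<Sum>d\<in>S. moebius_mu (p * d) :: 'a)"
    by (rule sum.reindex_bij_betw [symmetric])
  also have "\<dots> = (\<Sum>d\<in>S. - moebius_mu d)"
    using p(1) by (intro sum.cong refl)
      (simp add: S_def moebius_mu_mult_coprime prime_imp_coprime moebius_mu_prime)
  finally have "(\<Sum>d\<in>S \<union> T. moebius_mu d) = (0 :: 'a)"
    using fin by (subst sum.union_disjoint) (auto simp: S_def T_def sum_negf)
  moreover have "(\<Sum>d | d dvd n. moebius_mu d) = (\<Sum>d\<in>S \<union> T. moebius_mu d :: 'a)"
    using fin by (intro sum.mono_neutral_right)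
      (auto simp: S_def T_def moebius_mu_def split: if_splits)
  ultimately show ?thesis using False by simp
qed simp

text \<open>After swapping the sums, \<open>h t\<close> is weighted by the sum of mu over the
  divisors of \<open>n div t\<close>, which is nonzero only for \<open>t = n\<close>.\<close>

lemma eratosthenes_inversion:
  assumes "n > 0"
  shows "(\<Sum>d | d dvd n. eratosthenes h d) = h n"
proof -
  have "(\<Sum>d | d dvd n. eratosthenes h d)
      = (\<Sum>d | d dvd n. \<Sum>t | t dvd n \<and> t dvd d. h t * moebius_mu (d div t))"
    unfolding eratosthenes_def by (intro sum.cong refl) (auto intro: dvd_trans)
  also have "\<dots> = (\<Sum>t | t dvd n. \<Sum>d | d dvd n \<and> t dvd d. h t * moebius_mu (d div t))"
    using assms sum.swap_restrict[of "{d. d dvd n}" "{t. t dvd n}"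
        "\<lambda>d t. h t * moebius_mu (d div t)" "\<lambda>d t. t dvd d"] by simp
  also have "\<dots> = (\<Sum>t | t dvd n. h t * (\<Sum>k | k dvd n div t. moebius_mu k))"
  proof (intro sum.cong refl)
    fix t assume "t \<in> {t. t dvd n}"
    then obtain s where s: "n = t * s" "t > 0" "s > 0" using assms by auto
    have "(\<Sum>d | d dvd n \<and> t dvd d. h t * moebius_mu (d div t))
        = (\<Sum>k | k dvd s. h t * moebius_mu k)"
      using s by (intro sum.reindex_bij_witness[of _ "\<lambda>k. t * k" "\<lambda>d. d div t"]) auto
    then show "(\<Sum>d | d dvd n \<and> t dvd d. h t * moebius_mu (d div t))
        = h t * (\<Sum>k | k dvd n div t. moebius_mu k)"
      using s by (simp add: sum_distrib_left)
  qed
  also have "\<dots> = (\<Sum>t | t dvd n. if t = n then h t else 0)"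
    using assms by (intro sum.cong refl) (auto simp: sum_moebius_mu_divisors)
  also have "\<dots> = h n" using assms by simp
  finally show ?thesis .
qed

section \<open>The square-free kernel and the equivalent forms of the support condition\<close>

lemma squarefree_kernel_pos: "squarefree_kernel a > 0"
  unfolding squarefree_kernel_def by (intro prod_pos) (auto intro: prime_gt_0_nat)

lemma squarefree_squarefree_kernel: "squarefree (squarefree_kernel a)"
  unfolding squarefree_kernel_def
  by (intro squarefree_prod_coprime) (auto intro: primes_coprime squarefree_prime)

lemma squarefree_eq_prod_prime_factors:
  assumes "squarefree d"
  shows "\<Prod>(prime_factors d) = (d :: nat)"
proof -
  have "d \<noteq> 0" using assms by (auto intro!: Nat.gr0I)
  have "(\<Prod>p\<in>prime_factors d. p ^ multiplicity p d) = \<Prod>(prime_factors d)"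
    using assms \<open>d \<noteq> 0\<close>
    by (intro prod.cong refl) (auto simp: squarefree_factorial_semiring')
  with \<open>d \<noteq> 0\<close> show ?thesis by (simp add: prod_prime_factors)
qed

lemma squarefree_kernel_dvd:
  assumes "a > 0"
  shows "squarefree_kernel a dvd a"
proof -
  have "(\<Prod>p\<in>prime_factors a. p) dvd (\<Prod>p\<in>prime_factors a. p ^ multiplicity p a)"
    by (intro prod_dvd_prod) (auto simp: prime_factors_multiplicity intro!: dvd_power)
  then show ?thesis using assms by (simp add: squarefree_kernel_def prod_prime_factors)
qed

lemma squarefree_dvd_kernel_iff:
  assumes "squarefree d" "a > 0"
  shows "d dvd squarefree_kernel a \<longleftrightarrow> d dvd a"
proof
  assume "d dvd a"
  then have "prime_factors d \<subseteq> prime_factors a" using assms by (intro dvd_prime_factors) auto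
  then have "\<Prod>(prime_factors d) dvd \<Prod>(prime_factors a)" by (intro prod_dvd_prod_subset) auto
  with assms show "d dvd squarefree_kernel a"
    by (simp add: squarefree_kernel_def squarefree_eq_prod_prime_factors)
qed (use assms squarefree_kernel_dvd dvd_trans in blast)

text \<open>The square-free divisors of \<open>a\<close> are exactly the divisors of its kernel, so
  inversion at the kernel applies.\<close>

lemma sum_eratosthenes_squarefree_divisors:
  assumes "a > 0"
  shows "(\<Sum>d | d dvd a \<and> squarefree d. eratosthenes g d) = g (squarefree_kernel a)"
proof -
  have "(\<Sum>d | d dvd a \<and> squarefree d. eratosthenes g d)
      = (\<Sum>d | d dvd squarefree_kernel a. eratosthenes g d)"
    using assms squarefree_mono[OF _ squarefree_squarefree_kernel] squarefree_dvd_kernel_iff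
    by (intro sum.cong) blast+
  then show ?thesis by (simp add: eratosthenes_inversion squarefree_kernel_pos)
qed

text \<open>The difference of \<open>g a\<close> and \<open>g (squarefree_kernel a)\<close> is the
  sum of the transform over the non-square-free divisors of \<open>a\<close>. If it vanishes for all
  \<open>a\<close>, strong induction removes every proper divisor from the sum and leaves the
  transform at \<open>a\<close>. Vanishing of the transform off the square-free numbers is the
  common ground to which both sides of the claimed equivalence are reduced.\<close>

lemma kernel_invariant_iff_eratosthenes_squarefree:
  "(\<forall>a\<ge>1. g a = g (squarefree_kernel a)) \<longleftrightarrow>
   (\<forall>d\<ge>1. \<not> squarefree d \<longrightarrow> eratosthenes g d = 0)"
proof -
  have split: "g a = g (squarefree_kernel a) + (\<Sum>d | d dvd a \<and> \<not> squarefree d. eratosthenes g d)"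
    if "a > 0" for a
  proof -
    have "g a = (\<Sum>d | d dvd a. eratosthenes g d)" using that by (simp add: eratosthenes_inversion)
    also have "\<dots> = (\<Sum>d\<in>{d. d dvd a \<and> squarefree d} \<union> {d. d dvd a \<and> \<not> squarefree d}.
        eratosthenes g d)"
      by (intro sum.cong) auto
    also have "\<dots> = (\<Sum>d | d dvd a \<and> squarefree d. eratosthenes g d) +
        (\<Sum>d | d dvd a \<and> \<not> squarefree d. eratosthenes g d)"
      using that by (intro sum.union_disjoint) auto
    finally show ?thesis using that by (simp add: sum_eratosthenes_squarefree_divisors)
  qed
  show ?thesis
  proof (intro iffI allI impI)
    fix d :: nat
    assume inv: "\<forall>a\<ge>1. g a = g (squarefree_kernel a)"
    assume "d \<ge> 1" "\<not> squarefree d"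
    then show "eratosthenes g d = 0"
    proof (induction d rule: less_induct)
      case (less d)
      have "(\<Sum>t | t dvd d \<and> \<not> squarefree t. eratosthenes g t) = (\<Sum>t\<in>{d}. eratosthenes g t)"
      proof (intro sum.mono_neutral_right ballI)
        fix t assume t: "t \<in> {t. t dvd d \<and> \<not> squarefree t} - {d}"
        then have "t \<le> d" "t > 0" using less.prems by (auto intro: dvd_imp_le dvd_pos_nat)
        with t show "eratosthenes g t = 0" by (intro less.IH) auto
      qed (use less.prems in auto)
      with split[of d] inv less.prems show ?case by simp
    qed
  next
    fix a :: nat
    assume "\<forall>d\<ge>1. \<not> squarefree d \<longrightarrow> eratosthenes g d = 0" "a \<ge> 1"
    moreover from this have "(\<Sum>d | d dvd a \<and> \<not> squarefree d. eratosthenes g d) = 0"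
      by (intro sum.neutral) (auto intro: Suc_leI dvd_pos_nat)
    ultimately show "g a = g (squarefree_kernel a)" using split[of a] by simp
  qed
qed

text \<open>Multiples of a non-square-free number are non-square-free, so \<open>g_hat\<close>
  inherits the vanishing of the transform. Conversely, downward induction from \<open>Q\<close>
  kills the terms at proper multiples of \<open>d\<close> in \<open>g_hat Q g d\<close>, leaving the
  transform at \<open>d\<close> divided by \<open>d\<close>.\<close>

lemma g_hat_squarefree_iff_eratosthenes_squarefree:
  assumes "\<forall>d. d \<notin> {1..Q} \<longrightarrow> eratosthenes g d = 0"
  shows "(\<forall>l\<ge>1. g_hat Q g l = (moebius_mu l)\<^sup>2 * g_hat Q g l) \<longleftrightarrow>
    (\<forall>d\<ge>1. \<not> squarefree d \<longrightarrow> eratosthenes g d = 0)" (is "?L \<longleftrightarrow> ?R")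
proof -
  have L: "?L \<longleftrightarrow> (\<forall>l\<ge>1. \<not> squarefree l \<longrightarrow> g_hat Q g l = 0)"
    by (auto simp: moebius_mu_def simp flip: power_mult)
  show ?thesis
    unfolding L
  proof (intro iffI allI impI)
    fix d :: nat assume hat: "\<forall>l\<ge>1. \<not> squarefree l \<longrightarrow> g_hat Q g l = 0" and "d \<ge> 1" "\<not> squarefree d"
    then show "eratosthenes g d = 0"
    proof (induction "Q - d" arbitrary: d rule: less_induct)
      case less
      show ?case
      proof (cases "d \<le> Q")
        case True
        have "g_hat Q g d = (\<Sum>t\<in>{d}. eratosthenes g t / of_nat t)"
          unfolding g_hat_def
        proof (intro sum.mono_neutral_right ballI)
          fix t assume t: "t \<in> {t. t \<in> {1..Q} \<and> d dvd t} - {d}"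
          then have "d \<le> t" by (auto intro: dvd_imp_le)
          moreover have "\<not> squarefree t" using t less.prems squarefree_mono by blast
          ultimately have "eratosthenes g t = 0" using t less.prems by (intro less.hyps) auto
          then show "eratosthenes g t / of_nat t = 0" by simp
        qed (use True less.prems in auto)
        with less.prems show ?thesis by simp
      qed (use assms in auto)
    qed
  next
    fix l :: nat assume R: ?R and "l \<ge> 1" "\<not> squarefree l"
    have "eratosthenes g d = 0" if "d \<ge> 1" "l dvd d" for d
      using R that squarefree_mono[OF that(2)] \<open>\<not> squarefree l\<close> by blast
    then show "g_hat Q g l = 0"
      unfolding g_hat_def by (intro sum.neutral) auto
  qed
qed

section \<open>Dirichlet characters to a square-free modulus\<close>

lemma dirichlet_charD:
  assumes "dirichlet_char m \<chi>"
  shows "\<chi> (x * y) = \<chi> x * \<chi> y" "\<chi> (x + int m) = \<chi> x" "\<chi> x = 0 \<longleftrightarrow> \<not> coprime x (int m)"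
  using assms by (auto simp: dirichlet_char_def)

lemma dirichlet_char_1: "dirichlet_char m \<chi> \<Longrightarrow> \<chi> 1 = 1"
  using dirichlet_charD(1)[of m \<chi> 1 1] dirichlet_charD(3)[of m \<chi> 1] by simp

lemma dirichlet_char_power: "dirichlet_char m \<chi> \<Longrightarrow> \<chi> (x ^ k) = \<chi> x ^ k"
  by (induction k) (simp_all add: dirichlet_char_1 dirichlet_charD(1))

lemma dirichlet_char_cong:
  assumes "dirichlet_char m \<chi>" "[x = y] (mod int m)"
  shows "\<chi> x = \<chi> y"
proof -
  have nat: "\<chi> (z + int m * int k) = \<chi> z" for z k
  proof (induction k)
    case (Suc k)
    have "z + int m * int (Suc k) = (z + int m * int k) + int m" by (simp add: algebra_simps)
    then show ?case using Suc dirichlet_charD(2)[OF assms(1)] by metis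
  qed simp
  obtain k where k: "y = x + int m * k" using assms(2) by (metis cong_iff_lin)
  show ?thesis
  proof (cases "k \<ge> 0")
    case True
    with nat[of x "nat k"] k show ?thesis by simp
  \<comment> \<open>For negative \<open>k\<close> the periods are added starting from
    \<open>y\<close> instead of \<open>x\<close>.\<close>
  next
    case False
    with nat[of y "nat (- k)"] k show ?thesis by simp
  qed
qed

text \<open>By Euler's theorem the nonzero values are roots of unity. This yields both that
  conjugation inverts a character on the units and that there are only finitely many
  characters.\<close>

lemma dirichlet_char_power_totient:
  assumes "dirichlet_char m \<chi>" "coprime x (int m)"
  shows "\<chi> x ^ totient m = 1"
proof -
  have "\<chi> x ^ totient m = \<chi> (x ^ totient m)" using assms(1) by (simp add: dirichlet_char_power)
  also have "[x ^ totient m = 1] (mod int m)"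
  proof (cases "m = 0")
    case False
    define y where "y = nat (x mod int m)"
    have y: "int y = x mod int m" using False by (simp add: y_def)
    then have "[int y = x] (mod int m)" by (simp add: cong_def)
    moreover from this have "coprime y m" using assms(2)
      by (metis cong_imp_coprime cong_sym coprime_int_iff)
    then have "[y ^ totient m = 1] (mod m)" by (rule euler_theorem)
    then have "[int y ^ totient m = 1] (mod int m)" by (metis cong_int_iff of_nat_1 of_nat_power)
    ultimately show ?thesis by (meson cong_pow cong_sym cong_trans)
  qed simp
  then have "\<chi> (x ^ totient m) = \<chi> 1" by (rule dirichlet_char_cong[OF assms(1)])
  finally show ?thesis using dirichlet_char_1[OF assms(1)] by simp
qed

lemma dirichlet_char_mult_cnj:
  assumes "m > 0" "dirichlet_char m \<chi>" "coprime x (int m)"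
  shows "\<chi> x * cnj (\<chi> x) = 1"
proof -
  have "norm (\<chi> x) ^ totient m = 1"
    using dirichlet_char_power_totient[OF assms(2,3)] by (metis norm_one norm_power)
  then have "norm (\<chi> x) = 1"
    using assms(1) power_eq_1_iff[of "norm (\<chi> x)" "totient m"] by simp
  then show ?thesis using complex_norm_square[of "\<chi> x"] by simp
qed

text \<open>A character is determined by its restriction to one period, where each value is 0 or a
  root of unity of order dividing \<open>totient m\<close>.\<close>

lemma finite_dirichlet_chars:
  assumes "m > 0"
  shows "finite {\<chi>. dirichlet_char m \<chi>}"
proof -
  define V where "V = insert 0 {z :: complex. z ^ totient m = 1}"
  define F where "F = ({0..<int m} \<rightarrow>\<^sub>E V)"
  have "totient m \<ge> 1" using assms by (simp add: Suc_le_eq)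
  then have "finite V" unfolding V_def by (simp add: finite_roots_unity)
  then have "finite F" unfolding F_def by (intro finite_PiE) auto
  moreover have "{\<chi>. dirichlet_char m \<chi>} \<subseteq> (\<lambda>h x. h (x mod int m)) ` F"
  proof
    fix \<chi> assume "\<chi> \<in> {\<chi>. dirichlet_char m \<chi>}"
    then have \<chi>: "dirichlet_char m \<chi>" by simp
    have "\<chi> x \<in> V" for x
      using dirichlet_char_power_totient[OF \<chi>, of x] dirichlet_charD(3)[OF \<chi>, of x]
      by (auto simp: V_def)
    then have "restrict \<chi> {0..<int m} \<in> F" by (simp add: F_def)
    moreover have "\<chi> = (\<lambda>x. restrict \<chi> {0..<int m} (x mod int m))"
      using assms by (auto intro!: ext dirichlet_char_cong[OF \<chi>] simp: cong_def)
    ultimately show "\<chi> \<in> (\<lambda>h x. h (x mod int m)) ` F" by blast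
  qed
  ultimately show ?thesis by (metis finite_imageI finite_subset)
qed

lemma dirichlet_char_mult:
  "dirichlet_char m \<chi> \<Longrightarrow> dirichlet_char m \<psi> \<Longrightarrow> dirichlet_char m (\<lambda>x. \<chi> x * \<psi> x)"
  by (simp add: dirichlet_char_def)

lemma dirichlet_char_cnj: "dirichlet_char m \<chi> \<Longrightarrow> dirichlet_char m (\<lambda>x. cnj (\<chi> x))"
  by (simp add: dirichlet_char_def)

lemma dirichlet_char_principal: "dirichlet_char m (\<lambda>x. if coprime x (int m) then 1 else 0)"
proof -
  have "coprime (x + int m) (int m) \<longleftrightarrow> coprime x (int m)" for x
    by (simp add: coprime_iff_gcd_eq_1)
  then show ?thesis by (simp add: dirichlet_char_def)
qed

lemma int_coprime_cong_nat:
  assumes "m > 0" "coprime x (int m)"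
  obtains y where "[int y = x] (mod int m)" "coprime y m"
proof -
  have "[int (nat (x mod int m)) = x] (mod int m)" using assms(1) by (simp add: cong_def)
  then show thesis using that assms(2) by (metis cong_imp_coprime cong_sym coprime_int_iff)
qed

text \<open>The character is the exponential of the discrete logarithm to a primitive root
  \<open>g\<close> modulo \<open>p\<close>, set to 0 at arguments not coprime to \<open>m\<close>.
  It takes the value 1 at a unit only if that unit is 1 modulo \<open>p\<close>.\<close>

lemma dirichlet_char_separates:
  assumes p: "prime p" "p dvd m" and a: "coprime a (int m)" "\<not> [a = 1] (mod int p)"
  shows "\<exists>\<chi>. dirichlet_char m \<chi> \<and> \<chi> a \<noteq> 1"
proof -
  define n where "n = p - 1"
  have "p > 1" using p(1) prime_gt_1_nat by blast
  then have "n \<ge> 1" by (simp add: n_def)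
  obtain g where g: "residue_primroot p g" using prime_primitive_root_exists[OF \<open>p > 1\<close> p(1)] ..
  have ord: "ord p g = n" "coprime p g" using g p(1)
    by (auto simp: residue_primroot_def totient_prime n_def)
  define e where "e k = exp (2 * of_real pi * \<i> * of_nat k / of_nat n)" for k
  have e_add: "e (k + l) = e k * e l" for k l
    by (simp add: e_def exp_add [symmetric] add_divide_distrib ring_distribs)
  \<comment> \<open>Both sides say that \<open>k\<close> and \<open>l\<close> agree modulo
    \<open>n\<close>, the order of \<open>g\<close>. Hence \<open>e (ind x)\<close> does not depend
    on which discrete logarithm \<open>SOME\<close> picks, and \<open>e\<close> is injective on
    residues of exponents.\<close>
  have e_eq: "e k = e l \<longleftrightarrow> [int g ^ k = int g ^ l] (mod int p)" for k l
  proof -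
    have "e k = e l \<longleftrightarrow> [k = l] (mod n)"
      unfolding e_def cong_def by (rule complex_root_unity_eq) fact
    also have "\<dots> \<longleftrightarrow> [g ^ k = g ^ l] (mod p)" using ord by (simp add: order_divides_expdiff)
    also have "\<dots> \<longleftrightarrow> [int g ^ k = int g ^ l] (mod int p)" by (metis cong_int_iff of_nat_power)
    finally show ?thesis .
  qed
  define ind where "ind x = (SOME k. [int g ^ k = x] (mod int p))" for x
  have ind: "[int g ^ ind x = x] (mod int p)" if "coprime x (int m)" for x
  proof -
    have "coprime x (int p)" using that p(2) by (metis coprime_divisors dvd_refl int_dvd_int_iff)
    then obtain y where y: "[int y = x] (mod int p)" "coprime y p"
      using int_coprime_cong_nat \<open>p > 1\<close> by (metis less_trans zero_less_one)
    have "coprime (y mod p) p" using y(2) \<open>p > 1\<close> by simp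
    then have "y mod p \<in> totatives p" using \<open>p > 1\<close> by (auto simp: totatives_def intro!: Nat.gr0I)
    also have "totatives p = (\<lambda>i. g ^ i mod p) ` {..<totient p}"
      using residue_primroot_is_generator[OF \<open>p > 1\<close> g] by (simp add: bij_betw_def)
    finally obtain k where "g ^ k mod p = y mod p" by auto
    then have "[int g ^ k = int y] (mod int p)"
      by (metis cong_def cong_int_iff of_nat_power)
    with y(1) have "[int g ^ k = x] (mod int p)" by (rule cong_trans[rotated])
    then show ?thesis unfolding ind_def by (rule someI)
  qed
  define \<chi> where "\<chi> x = (if coprime x (int m) then e (ind x) else 0)" for x
  have "\<chi> (x * y) = \<chi> x * \<chi> y" for x y
  proof (cases "coprime x (int m) \<and> coprime y (int m)")
    case True
    then have "[int g ^ ind (x * y) = int g ^ (ind x + ind y)] (mod int p)"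
      using ind[of x] ind[of y] ind[of "x * y"]
      by (metis cong_mult cong_sym cong_trans coprime_mult_left_iff power_add)
    with True show ?thesis by (simp add: \<chi>_def e_eq flip: e_add)
  qed (auto simp: \<chi>_def)
  moreover have "\<chi> (x + int m) = \<chi> x" for x
  proof -
    have cop: "coprime (x + int m) (int m) \<longleftrightarrow> coprime x (int m)"
      by (simp add: coprime_iff_gcd_eq_1)
    moreover have "[x + int m = x] (mod int p)" using p(2) by (simp add: cong_iff_dvd_diff)
    ultimately have "[int g ^ ind (x + int m) = int g ^ ind x] (mod int p)"
      if "coprime x (int m)" using ind that by (meson cong_sym cong_trans)
    with cop show ?thesis by (simp add: \<chi>_def e_eq)
  qed
  moreover have "\<chi> x \<noteq> 0 \<longleftrightarrow> coprime x (int m)" for x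
    by (simp add: \<chi>_def e_def)
  ultimately have "dirichlet_char m \<chi>" by (simp add: dirichlet_char_def)
  moreover have "\<chi> a \<noteq> 1"
  proof
    assume "\<chi> a = 1"
    then have "e (ind a) = e 0" using a(1) by (simp add: \<chi>_def e_def)
    then have "[int g ^ ind a = 1] (mod int p)" by (simp add: e_eq)
    with ind[OF a(1)] a(2) show False by (meson cong_sym cong_trans)
  qed
  ultimately show ?thesis by blast
qed

section \<open>Orthogonality relations for characters\<close>

lemma squarefree_dvdI:
  assumes "squarefree m" "\<And>p. prime p \<Longrightarrow> p dvd m \<Longrightarrow> int p dvd x"
  shows "int m dvd x"
proof -
  have "m dvd nat \<bar>x\<bar>"
  proof (cases "x = 0")
    case False
    have "prime_factors m \<subseteq> prime_factors (nat \<bar>x\<bar>)"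
      using assms(2) False by (auto simp: in_prime_factors_iff)
    then have "\<Prod>(prime_factors m) dvd squarefree_kernel (nat \<bar>x\<bar>)"
      unfolding squarefree_kernel_def by (intro prod_dvd_prod_subset) auto
    also have "\<dots> dvd nat \<bar>x\<bar>" using False by (intro squarefree_kernel_dvd) simp
    finally show ?thesis using squarefree_eq_prod_prime_factors[OF assms(1)] by simp
  qed simp
  then show ?thesis by simp
qed

text \<open>As \<open>m\<close> is square-free, \<open>a\<close> already differs from 1 modulo some
  prime factor of \<open>m\<close>, so some character \<open>\<psi>\<close> has
  \<open>\<psi> a \<noteq> 1\<close>. Multiplication by \<open>\<psi>\<close> permutes the
  characters, so the sum equals \<open>\<psi> a\<close> times itself.\<close>

lemma dirichlet_char_sum_nonone:
  assumes m: "m > 0" "squarefree m" and a: "coprime a (int m)" "\<not> [a = 1] (mod int m)"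
  shows "(\<Sum>\<chi> | dirichlet_char m \<chi>. \<chi> a) = 0"
proof -
  have "\<exists>p. prime p \<and> p dvd m \<and> \<not> [a = 1] (mod int p)"
    using squarefree_dvdI[OF m(2), of "a - 1"] a(2) by (auto simp: cong_iff_dvd_diff)
  then obtain \<psi> where \<psi>: "dirichlet_char m \<psi>" "\<psi> a \<noteq> 1"
    using dirichlet_char_separates a(1) by metis
  let ?f = "\<lambda>\<phi> \<chi> x. \<phi> x * \<chi> x :: complex"
  \<comment> \<open>On units conjugation inverts \<open>\<psi>\<close>; off the units
    \<open>\<chi> x\<close> is 0 anyway.\<close>
  have inv: "\<psi> x * (cnj (\<psi> x) * \<chi> x) = \<chi> x" if "dirichlet_char m \<chi>" for \<chi> x
    using dirichlet_char_mult_cnj[OF m(1) \<psi>(1), of x] dirichlet_charD(3)[OF that, of x]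
    by (cases "coprime x (int m)") (simp_all flip: mult.assoc)
  have "(\<Sum>\<chi> | dirichlet_char m \<chi>. \<chi> a) = (\<Sum>\<chi> | dirichlet_char m \<chi>. \<psi> a * \<chi> a)"
  proof (rule sum.reindex_bij_witness[of _ "?f \<psi>" "?f (\<lambda>x. cnj (\<psi> x))"])
    fix \<chi> assume "\<chi> \<in> {\<chi>. dirichlet_char m \<chi>}"
    then have \<chi>: "dirichlet_char m \<chi>" by simp
    show "?f \<psi> (?f (\<lambda>x. cnj (\<psi> x)) \<chi>) = \<chi>" using inv[OF \<chi>] by auto
    show "?f (\<lambda>x. cnj (\<psi> x)) (?f \<psi> \<chi>) = \<chi>" using inv[OF \<chi>] by (auto simp: mult_ac)
    show "?f \<psi> \<chi> \<in> {\<chi>. dirichlet_char m \<chi>}" "?f (\<lambda>x. cnj (\<psi> x)) \<chi> \<in> {\<chi>. dirichlet_char m \<chi>}"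
      using dirichlet_char_mult \<psi>(1) \<chi> dirichlet_char_cnj by auto
    show "\<psi> a * (cnj (\<psi> a) * \<chi> a) = \<chi> a" using inv[OF \<chi>] .
  qed
  also have "\<dots> = \<psi> a * (\<Sum>\<chi> | dirichlet_char m \<chi>. \<chi> a)" by (simp add: sum_distrib_left)
  finally show ?thesis using \<psi>(2) by (metis mult_cancel_right2)
qed

text \<open>The dual argument: multiplication by \<open>y\<close> permutes the residues, with
  inverse multiplication by \<open>z\<close>, so the sum equals \<open>\<chi> y\<close> times
  itself.\<close>

lemma sum_dirichlet_char_residues:
  assumes m: "m > 0" and \<chi>: "dirichlet_char m \<chi>" and y: "coprime y (int m)" "\<chi> y \<noteq> 1"
  shows "(\<Sum>x\<in>{0..<int m}. \<chi> x) = 0"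
proof -
  obtain z where z: "[y * z = 1] (mod int m)" using cong_solve_coprime_int[OF y(1)] ..
  then have z': "[z * y = 1] (mod int m)" by (simp add: mult.commute)
  have cong: "[u * (v * x mod int m) = x] (mod int m)" if "[u * v = 1] (mod int m)" for u v x
  proof -
    have "[u * (v * x mod int m) = u * (v * x)] (mod int m)"
      by (intro cong_scalar_left) (simp add: cong_def)
    also have "[u * (v * x) = x] (mod int m)"
      using cong_scalar_right[OF that, of x] by (simp add: mult.assoc)
    finally show ?thesis .
  qed
  then have cancel: "u * (v * x mod int m) mod int m = x"
    if "[u * v = 1] (mod int m)" "x \<in> {0..<int m}" for u v x
    using that by (metis atLeastLessThan_iff cong_def mod_pos_pos_trivial)
  have "(\<Sum>x\<in>{0..<int m}. \<chi> x) = (\<Sum>x\<in>{0..<int m}. \<chi> (y * x))"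
  proof (rule sum.reindex_bij_witness[of _ "\<lambda>x. y * x mod int m" "\<lambda>x. z * x mod int m"])
    fix x assume x: "x \<in> {0..<int m}"
    show "y * (z * x mod int m) mod int m = x" "z * (y * x mod int m) mod int m = x"
      using cancel[OF z x] cancel[OF z' x] .
    show "z * x mod int m \<in> {0..<int m}" "y * x mod int m \<in> {0..<int m}" using m by auto
    show "\<chi> (y * (z * x mod int m)) = \<chi> x" by (rule dirichlet_char_cong[OF \<chi> cong[OF z]])
  qed
  also have "\<dots> = \<chi> y * (\<Sum>x\<in>{0..<int m}. \<chi> x)"
    by (simp add: dirichlet_charD(1)[OF \<chi>] sum_distrib_left)
  finally show ?thesis using y(2) by (metis mult_cancel_right2)
qed

lemma card_coprime_residues:
  assumes "m > 0"
  shows "card {x\<in>{0..<int m}. coprime x (int m)} = totient m"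
proof -
  \<comment> \<open>The reduction modulo \<open>m\<close> only matters for \<open>m = 1\<close>,
    where the totative 1 must be sent to the residue 0.\<close>
  have "bij_betw (\<lambda>k. int k mod int m) (totatives m) {x\<in>{0..<int m}. coprime x (int m)}"
  proof (cases "m = 1")
    case False
    then have "\<And>k. k \<in> totatives m \<Longrightarrow> k < m" using assms totatives_less by simp
    moreover have "nat x \<in> totatives m" if "coprime x (int m)" "x \<ge> 0" "x < int m" for x
    proof -
      have "x \<noteq> 0" using that False assms by auto
      moreover have "coprime (nat x) m" using that by (metis coprime_int_iff nat_0_le)
      ultimately show ?thesis using that by (simp add: in_totatives_iff nat_le_iff)
    qed
    ultimately show ?thesis using assms
      by (intro bij_betw_byWitness[where f' = nat]) (auto simp: in_totatives_iff)
  qed (auto simp: bij_betw_def)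
  then show ?thesis unfolding totient_def by (rule bij_betw_same_card[symmetric])
qed

text \<open>Double counting of the sum of \<open>\<chi> x\<close> over all characters and residues.
  Summing over characters first leaves only the residue of 1, which gives the number of characters;
  summing over residues first leaves only the principal character, which gives
  \<open>totient m\<close>.\<close>

lemma card_dirichlet_chars:
  assumes m: "m > 0" "squarefree m"
  shows "card {\<chi>. dirichlet_char m \<chi>} = totient m"
proof -
  let ?D = "{\<chi>. dirichlet_char m \<chi>}" and ?R = "{0..<int m}"
  define \<chi>\<^sub>0 :: "int \<Rightarrow> complex" where "\<chi>\<^sub>0 x = (if coprime x (int m) then 1 else 0)" for x
  have \<chi>\<^sub>0: "\<chi>\<^sub>0 \<in> ?D" using dirichlet_char_principal[of m] by (simp add: \<chi>\<^sub>0_def[abs_def])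
  \<comment> \<open>The residue is written \<open>1 mod int m\<close> so that it lies in
    \<open>?R\<close> even for \<open>m = 1\<close>.\<close>
  have one: "\<chi> (1 mod int m) = 1" if "\<chi> \<in> ?D" for \<chi>
    using dirichlet_char_cong[of m \<chi> "1 mod int m" 1] that by (simp add: dirichlet_char_1 cong_def)
  have "of_nat (card ?D) = (\<Sum>\<chi>\<in>?D. 1 :: complex)" by simp
  also have "\<dots> = (\<Sum>\<chi>\<in>?D. \<chi> (1 mod int m))" by (intro sum.cong refl one [symmetric])
  also have "\<dots> = (\<Sum>x\<in>{1 mod int m}. \<Sum>\<chi>\<in>?D. \<chi> x)" by simp
  also have "\<dots> = (\<Sum>x\<in>?R. \<Sum>\<chi>\<in>?D. \<chi> x)"
  proof (intro sum.mono_neutral_left ballI)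
    fix x assume x: "x \<in> ?R - {1 mod int m}"
    then have "\<not> [x = 1] (mod int m)" by (auto simp: cong_def)
    with dirichlet_char_sum_nonone[OF m, of x] dirichlet_charD(3)[of m _ x]
    show "(\<Sum>\<chi>\<in>?D. \<chi> x) = 0"
      by (cases "coprime x (int m)") (auto intro: sum.neutral)
  qed (use m in auto)
  also have "\<dots> = (\<Sum>\<chi>\<in>?D. \<Sum>x\<in>?R. \<chi> x)" by (rule sum.swap)
  also have "\<dots> = (\<Sum>\<chi>\<in>{\<chi>\<^sub>0}. \<Sum>x\<in>?R. \<chi> x)"
  proof (intro sum.mono_neutral_right ballI)
    fix \<chi> assume \<chi>: "\<chi> \<in> ?D - {\<chi>\<^sub>0}"
    then have "\<chi> \<noteq> \<chi>\<^sub>0" by simp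
    \<comment> \<open>Both characters vanish off the units, so they must differ at a unit, where
      \<open>\<chi>\<^sub>0\<close> is 1.\<close>
    then obtain y where "\<chi> y \<noteq> \<chi>\<^sub>0 y" by (meson ext)
    with \<chi> dirichlet_charD(3)[of m \<chi> y] have "coprime y (int m)" "\<chi> y \<noteq> 1"
      by (auto simp: \<chi>\<^sub>0_def split: if_splits)
    with \<chi> show "(\<Sum>x\<in>?R. \<chi> x) = 0" using sum_dirichlet_char_residues[OF m(1)] by blast
  qed (use finite_dirichlet_chars[OF m(1)] \<chi>\<^sub>0 in auto)
  also have "\<dots> = (\<Sum>x\<in>?R. \<chi>\<^sub>0 x)" by simp
  also have "\<dots> = (\<Sum>x\<in>{x\<in>?R. coprime x (int m)}. 1)"
    unfolding \<chi>\<^sub>0_def by (rule sum.inter_filter [symmetric]) simp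
  also have "\<dots> = of_nat (card {x\<in>?R. coprime x (int m)})" by simp
  also have "\<dots> = of_nat (totient m)" using m(1) by (simp only: card_coprime_residues)
  finally show ?thesis by (simp only: of_nat_eq_iff)
qed

text \<open>For units, let \<open>c\<close> be an inverse of \<open>b\<close> modulo
  \<open>m\<close>. Then the conjugate of \<open>\<chi> b\<close> is \<open>\<chi> c\<close>, and
  the sum becomes that of \<open>\<chi> (c * a)\<close>, which is \<open>totient m\<close> or 0
  according to whether \<open>c * a\<close> is 1 modulo \<open>m\<close>.\<close>

lemma dirichlet_char_orthogonality:
  assumes m: "m > 0" "squarefree m"
  shows "(\<Sum>\<chi> | dirichlet_char m \<chi>. cnj (\<chi> b) * \<chi> a) =
    (if coprime b (int m) \<and> [b = a] (mod int m) then of_nat (totient m) else 0)"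
proof (cases "coprime b (int m) \<and> coprime a (int m)")
  case True
  then obtain c where c: "[b * c = 1] (mod int m)" using cong_solve_coprime_int by blast
  then have "coprime c (int m)"
    by (metis cong_imp_coprime cong_sym coprime_1_left coprime_mult_left_iff)
  have *: "cnj (\<chi> b) * \<chi> a = \<chi> (c * a)" if \<chi>: "dirichlet_char m \<chi>" for \<chi>
  proof -
    have "\<chi> b * \<chi> c = 1"
      using dirichlet_char_cong[OF \<chi> c] by (simp add: dirichlet_charD(1)[OF \<chi>] dirichlet_char_1[OF \<chi>])
    moreover have "\<chi> b * cnj (\<chi> b) = 1" using dirichlet_char_mult_cnj m(1) \<chi> True by blast
    ultimately have "cnj (\<chi> b) = \<chi> c" by (metis mult_cancel_left mult_zero_left zero_neq_one)
    then show ?thesis by (simp add: dirichlet_charD(1)[OF \<chi>])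
  qed
  have iff: "[c * a = 1] (mod int m) \<longleftrightarrow> [b = a] (mod int m)"
  proof
    assume "[c * a = 1] (mod int m)"
    then have "[b * (c * a) = b] (mod int m)" using cong_scalar_left[of "c * a" 1 _ b] by simp
    moreover have "[b * (c * a) = a] (mod int m)"
      using cong_scalar_right[OF c, of a] by (simp add: mult.assoc)
    ultimately show "[b = a] (mod int m)" by (meson cong_sym cong_trans)
  next
    assume "[b = a] (mod int m)"
    then have "[c * b = c * a] (mod int m)" by (rule cong_scalar_left)
    with c show "[c * a = 1] (mod int m)" by (metis cong_sym cong_trans mult.commute)
  qed
  have "(\<Sum>\<chi> | dirichlet_char m \<chi>. cnj (\<chi> b) * \<chi> a) = (\<Sum>\<chi> | dirichlet_char m \<chi>. \<chi> (c * a))"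
    by (intro sum.cong refl) (simp add: *)
  also have "\<dots> = (if [c * a = 1] (mod int m) then of_nat (totient m) else 0)"
  proof (cases "[c * a = 1] (mod int m)")
    case True
    then have "(\<Sum>\<chi> | dirichlet_char m \<chi>. \<chi> (c * a)) = (\<Sum>\<chi> | dirichlet_char m \<chi>. 1)"
      by (intro sum.cong refl) (metis dirichlet_char_1 dirichlet_char_cong mem_Collect_eq)
    with True m show ?thesis by (simp add: card_dirichlet_chars)
  next
    case False
    then show ?thesis
      using dirichlet_char_sum_nonone[OF m] True \<open>coprime c (int m)\<close> by simp
  qed
  finally show ?thesis using iff True by simp
next
  case False
  then have "cnj (\<chi> b) * \<chi> a = 0" if "dirichlet_char m \<chi>" for \<chi>
    using dirichlet_charD(3)[OF that] by auto
  then have "(\<Sum>\<chi> | dirichlet_char m \<chi>. cnj (\<chi> b) * \<chi> a) = 0" by (intro sum.neutral) auto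
  moreover have "\<not> (coprime b (int m) \<and> [b = a] (mod int m))"
    using False cong_imp_coprime by blast
  ultimately show ?thesis by (simp only: if_False)
qed

section \<open>The decomposition of the correlation\<close>

lemma g_hat_eq_0:
  assumes "l > Q"
  shows "g_hat Q g l = 0"
proof -
  have "{d. d \<in> {1..Q} \<and> l dvd d} = {}" using assms by (auto dest!: dvd_imp_le)
  then show ?thesis unfolding g_hat_def by (simp only: sum.empty)
qed

lemma eratosthenes_squarefree:
  assumes "squarefree q"
  shows "eratosthenes h q = moebius_mu q * (\<Sum>t | t dvd q. moebius_mu t * h t)"
  unfolding eratosthenes_def sum_distrib_left
  by (intro sum.cong refl) (simp add: moebius_mu_div[OF assms] mult_ac)

lemma ramanujan_expansion:
  assumes supp: "\<forall>d. d \<notin> {1..Q} \<longrightarrow> eratosthenes g d = 0"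
    and sqf: "\<forall>l\<ge>1. g_hat Q g l = (moebius_mu l)\<^sup>2 * g_hat Q g l" and n: "n > 0"
  shows "g n = (\<Sum>q=1..Q. moebius_mu q * g_hat Q g q *
    (\<Sum>m | m dvd q \<and> m dvd n. moebius_mu m * of_nat m))"
proof -
  \<comment> \<open>For \<open>d > 0\<close> the quotient of \<open>h d\<close> by \<open>d\<close>
    is the indicator of \<open>d dvd n\<close>. Expanding \<open>h d\<close> as the sum of its
    transform over \<open>q dvd d\<close> and summing over \<open>d\<close> first produces
    \<open>g_hat Q g q\<close>.\<close>
  define h :: "nat \<Rightarrow> complex" where "h m = (if m dvd n then of_nat m else 0)" for m
  have "g n = (\<Sum>d | d dvd n. eratosthenes g d)" using n by (simp add: eratosthenes_inversion)
  also have "\<dots> = (\<Sum>d=1..Q. eratosthenes g d / of_nat d * h d)"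
    using n supp by (intro sum.mono_neutral_cong) (auto simp: h_def)
  also have "\<dots> = (\<Sum>d=1..Q. \<Sum>q | q \<in> {1..Q} \<and> q dvd d.
      eratosthenes h q * (eratosthenes g d / of_nat d))"
  proof (intro sum.cong refl)
    fix d assume d: "d \<in> {1..Q}"
    then have "{q. q \<in> {1..Q} \<and> q dvd d} = {q. q dvd d}"
      by (auto dest: dvd_imp_le intro!: Suc_leI Nat.gr0I)
    then have "(\<Sum>q | q \<in> {1..Q} \<and> q dvd d. eratosthenes h q * (eratosthenes g d / of_nat d))
        = (\<Sum>q | q dvd d. eratosthenes h q) * (eratosthenes g d / of_nat d)"
      by (simp only: sum_distrib_right)
    with d show "eratosthenes g d / of_nat d * h d =
        (\<Sum>q | q \<in> {1..Q} \<and> q dvd d. eratosthenes h q * (eratosthenes g d / of_nat d))"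
      by (simp add: eratosthenes_inversion)
  qed
  also have "\<dots> = (\<Sum>q=1..Q. \<Sum>d | d \<in> {1..Q} \<and> q dvd d.
      eratosthenes h q * (eratosthenes g d / of_nat d))"
    by (rule sum.swap_restrict) auto
  also have "\<dots> = (\<Sum>q=1..Q. eratosthenes h q * g_hat Q g q)"
    unfolding g_hat_def sum_distrib_left ..
  also have "\<dots> = (\<Sum>q=1..Q. moebius_mu q * g_hat Q g q *
    (\<Sum>m | m dvd q \<and> m dvd n. moebius_mu m * of_nat m))"
  proof (intro sum.cong refl)
    fix q assume q: "q \<in> {1..Q}"
    show "eratosthenes h q * g_hat Q g q = moebius_mu q * g_hat Q g q *
      (\<Sum>m | m dvd q \<and> m dvd n. moebius_mu m * of_nat m)"
    proof (cases "squarefree q")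
      case True
      have "(\<Sum>t | t dvd q. moebius_mu t * h t) = (\<Sum>m | m dvd q \<and> m dvd n. moebius_mu m * of_nat m)"
        using q by (intro sum.mono_neutral_cong_right) (auto simp: h_def)
      then show ?thesis using eratosthenes_squarefree[OF True] by simp
    next
      case False
      then have "g_hat Q g q = 0" using sqf q by (auto simp: moebius_mu_not_squarefree)
      then show ?thesis by simp
    qed
  qed
  finally show ?thesis .
qed

section \<open>Splitting the expansion at \<open>p + a\<close> into the two terms\<close>

lemma cong_minus_iff_dvd: "[- int p = int a] (mod int m) \<longleftrightarrow> m dvd p + a"
proof -
  have "[- int p = int a] (mod int m) \<longleftrightarrow> int m dvd - int (p + a)"
    by (simp add: cong_iff_dvd_diff)
  then show ?thesis by (simp only: dvd_minus_iff int_dvd_int_iff)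
qed

lemma cong_minus_one_iff_dvd: "[int b = - 1] (mod int m) \<longleftrightarrow> m dvd b + 1"
proof -
  have "[int b = - 1] (mod int m) \<longleftrightarrow> int m dvd int (b + 1)"
    by (simp add: cong_iff_dvd_diff add.commute)
  then show ?thesis by (simp only: int_dvd_int_iff)
qed

text \<open>Since \<open>g_hat\<close> vanishes beyond \<open>Q\<close>, only \<open>q'\<close> and
  \<open>p\<close> up to \<open>Q\<close> can contribute; this replaces the infinite sum by a finite
  one.\<close>

lemma S_term_finite:
  assumes "a > 0"
  shows "S_term f Q g a = (\<Sum>p | prime p \<and> p dvd a \<and> p \<le> Q. f p * of_nat p *
    (\<Sum>q'=1..Q. moebius_mu q' * g_hat Q g (p * q') *
      (\<Sum>m' | m' dvd q' \<and> m' dvd a div p + 1. moebius_mu m' * of_nat m')))"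
proof -
  let ?t = "\<lambda>p q'. moebius_mu q' * g_hat Q g (p * q') *
      (\<Sum>m' | m' dvd q' \<and> m' dvd a div p + 1. moebius_mu m' * of_nat m')"
  have inf: "infsum (?t p) {1..} = sum (?t p) {1..Q}" if "prime p" for p
  proof -
    have "p * q' > Q" if "q' > Q" for q'
      using \<open>prime p\<close> that by (metis less_le_trans mult_le_mono1 mult_1 prime_ge_1_nat)
    then have "infsum (?t p) {1..} = infsum (?t p) {1..Q}"
      by (intro infsum_cong_neutral) (auto simp: g_hat_eq_0)
    then show ?thesis by simp
  qed
  have "S_term f Q g a = (\<Sum>p | prime p \<and> p dvd a. f p * of_nat p * sum (?t p) {1..Q})"
    unfolding S_term_def cong_minus_one_iff_dvd by (intro sum.cong refl) (simp only: inf mem_Collect_eq)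
  also have "\<dots> = (\<Sum>p | prime p \<and> p dvd a \<and> p \<le> Q. f p * of_nat p * sum (?t p) {1..Q})"
  proof (intro sum.mono_neutral_right ballI)
    fix p assume p: "p \<in> {p. prime p \<and> p dvd a} - {p. prime p \<and> p dvd a \<and> p \<le> Q}"
    have "p * q' > Q" if "q' \<ge> 1" for q'
      using p that by (metis (no_types, lifting) DiffE less_le_trans linorder_not_le mem_Collect_eq mult_le_mono2 mult.right_neutral)
    then have "sum (?t p) {1..Q} = 0" by (intro sum.neutral) (auto simp: g_hat_eq_0)
    then show "f p * of_nat p * sum (?t p) {1..Q} = 0" by simp
  qed (use assms in auto)
  finally show ?thesis .
qed

text \<open>Substitute \<open>q = p * q'\<close> and \<open>m = p * m'\<close>, with
  \<open>p + a = p * (a div p + 1)\<close>. The weights mu(q) and mu(m) each change sign, so the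
  signs cancel, and the factor \<open>m\<close> supplies the factor \<open>p\<close>.\<close>

lemma g_hat_prime_multiples:
  assumes sqf: "\<forall>l\<ge>1. g_hat Q g l = (moebius_mu l)\<^sup>2 * g_hat Q g l"
    and p: "prime p" "p dvd a" and a: "a > 0"
  shows "(\<Sum>q=1..Q. moebius_mu q * g_hat Q g q *
      (\<Sum>m | m dvd q \<and> p dvd m \<and> m dvd p + a. moebius_mu m * of_nat m)) =
    of_nat p * (\<Sum>q'=1..Q. moebius_mu q' * g_hat Q g (p * q') *
      (\<Sum>m' | m' dvd q' \<and> m' dvd a div p + 1. moebius_mu m' * of_nat m'))"
proof -
  obtain b where b: "a = p * b" using p(2) by blast
  have "p > 0" using p(1) prime_gt_0_nat by blast
  then have b': "a div p = b" by (simp add: b)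
  have pa: "p + a = p * (b + 1)" by (simp add: b)
  let ?A = "\<lambda>q. \<Sum>m | m dvd q \<and> p dvd m \<and> m dvd p + a. moebius_mu m * of_nat m :: complex"
  let ?B = "\<lambda>q'. \<Sum>m' | m' dvd q' \<and> m' dvd b + 1. moebius_mu m' * of_nat m' :: complex"
  have mu: "moebius_mu (p * k) = (- moebius_mu k :: complex)" if "squarefree (p * k)" for k
    using squarefree_mult_imp_coprime[OF that] p(1)
    by (simp add: moebius_mu_mult_coprime moebius_mu_prime)
  have AB: "?A (p * q') = - of_nat p * ?B q'" if "squarefree (p * q')" for q'
  proof -
    have "?A (p * q') = (\<Sum>m' | m' dvd q' \<and> m' dvd b + 1. moebius_mu (p * m') * of_nat (p * m'))"
    proof (rule sum.reindex_bij_witness[of _ "\<lambda>m'. p * m'" "\<lambda>m. m div p"])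
      fix m assume m: "m \<in> {m. m dvd p * q' \<and> p dvd m \<and> m dvd p + a}"
      then obtain m' where "m = p * m'" by blast
      moreover from this have "p * m' dvd p * q'" "p * m' dvd p * (b + 1)"
        using m unfolding pa by blast+
      ultimately have "m = p * m'" "m' dvd q'" "m' dvd b + 1"
        using \<open>p > 0\<close> by (simp_all only: nat_mult_dvd_cancel1)
      with \<open>p > 0\<close> show "m div p \<in> {m'. m' dvd q' \<and> m' dvd b + 1}" "p * (m div p) = m"
        "moebius_mu (p * (m div p)) * of_nat (p * (m div p)) = (moebius_mu m * of_nat m :: complex)"
        by simp_all
    next
      fix m' assume "m' \<in> {m'. m' dvd q' \<and> m' dvd b + 1}"
      then have "p * m' dvd p * q'" "p * m' dvd p * (b + 1)" by (blast intro: mult_dvd_mono dvd_refl)+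
      then show "p * m' \<in> {m. m dvd p * q' \<and> p dvd m \<and> m dvd p + a}" "p * m' div p = m'"
        using \<open>p > 0\<close> unfolding pa by simp_all
    qed
    also have "\<dots> = (\<Sum>m' | m' dvd q' \<and> m' dvd b + 1. - of_nat p * (moebius_mu m' * of_nat m'))"
    proof (intro sum.cong refl)
      fix m' assume "m' \<in> {m'. m' dvd q' \<and> m' dvd b + 1}"
      then have "p * m' dvd p * q'" by (intro mult_dvd_mono) auto
      then have "squarefree (p * m')" using that by (rule squarefree_mono)
      then show "moebius_mu (p * m') * of_nat (p * m') =
          (- of_nat p * (moebius_mu m' * of_nat m') :: complex)" by (simp add: mu)
    qed
    finally show ?thesis by (simp only: sum_distrib_left)
  qed
  let ?X = "{q\<in>{1..Q}. p dvd q \<and> squarefree q}"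
  let ?Y = "{q'\<in>{1..Q}. p * q' \<le> Q \<and> squarefree (p * q')}"
  have hat0: "g_hat Q g q = 0" if "\<not> squarefree q" for q
  \<comment> \<open>The hypothesis speaks of positive arguments only; at 0 the sum defining
    \<open>g_hat\<close> has no nonzero terms.\<close>
  proof (cases "q = 0")
    case True
    then show ?thesis unfolding g_hat_def by (intro sum.neutral) auto
  next
    case False
    with sqf have "g_hat Q g q = (moebius_mu q)\<^sup>2 * g_hat Q g q" by simp
    with that show ?thesis by (simp add: moebius_mu_not_squarefree)
  qed
  have "(\<Sum>q=1..Q. moebius_mu q * g_hat Q g q * ?A q) = (\<Sum>q\<in>?X. moebius_mu q * g_hat Q g q * ?A q)"
  proof (intro sum.mono_neutral_right ballI)
    fix q assume q: "q \<in> {1..Q} - ?X"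
    show "moebius_mu q * g_hat Q g q * ?A q = 0"
    proof (cases "squarefree q")
      case True
      with q have "\<not> p dvd q" by auto
      then have "{m. m dvd q \<and> p dvd m \<and> m dvd p + a} = {}" by (auto dest: dvd_trans)
      then show ?thesis by (simp only: sum.empty mult_zero_right)
    qed (simp add: hat0)
  qed auto
  also have "\<dots> = (\<Sum>q'\<in>?Y. moebius_mu (p * q') * g_hat Q g (p * q') * ?A (p * q'))"
    using \<open>p > 0\<close>
    by (intro sum.reindex_bij_witness[of _ "\<lambda>q'. p * q'" "\<lambda>q. q div p"])
      (auto elim!: dvdE intro: order_trans[rotated] Nat.gr0I)
  also have "\<dots> = (\<Sum>q'\<in>?Y. of_nat p * (moebius_mu q' * g_hat Q g (p * q') * ?B q'))"
  proof (intro sum.cong refl)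
    fix q' assume "q' \<in> ?Y"
    then have "squarefree (p * q')" by blast
    from mu[OF this] AB[OF this]
    show "moebius_mu (p * q') * g_hat Q g (p * q') * ?A (p * q')
        = of_nat p * (moebius_mu q' * g_hat Q g (p * q') * ?B q')"
      by (simp only:) simp
  qed
  also have "\<dots> = (\<Sum>q'=1..Q. of_nat p * (moebius_mu q' * g_hat Q g (p * q') * ?B q'))"
    by (intro sum.mono_neutral_left ballI) (auto simp: hat0 g_hat_eq_0)
  finally show ?thesis by (simp only: b' sum_distrib_left)
qed

lemma correlation_eq_P_term_plus_S_term:
  assumes QN: "Q \<le> N" and supp: "\<forall>d. d \<notin> {1..Q} \<longrightarrow> eratosthenes g d = 0"
    and sqf: "\<forall>l\<ge>1. g_hat Q g l = (moebius_mu l)\<^sup>2 * g_hat Q g l"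
    and f: "\<forall>n\<ge>1. \<not> prime n \<longrightarrow> f n = 0" and a: "a > 0"
  shows "correlation f g N a = P_term f Q g N a + S_term f Q g a"
proof -
  let ?P = "{p. prime p \<and> p \<le> N}"
  let ?w = "\<lambda>q. moebius_mu q * g_hat Q g q"
  let ?c = "\<lambda>m. moebius_mu m * of_nat m :: complex"
  let ?U = "\<lambda>q p. \<Sum>m | m dvd q \<and> coprime p m \<and> m dvd p + a. ?c m"
  let ?V = "\<lambda>q p. \<Sum>m | m dvd q \<and> p dvd m \<and> m dvd p + a. ?c m"
  have fin: "finite ?P" by simp
  have "correlation f g N a = (\<Sum>p\<in>?P. f p * g (p + a))"
    unfolding correlation_def using f
    by (intro sum.mono_neutral_right) (auto simp: prime_ge_1_nat Suc_leI prime_gt_0_nat)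
  also have "\<dots> = (\<Sum>p\<in>?P. \<Sum>q=1..Q. f p * (?w q * ?U q p) + f p * (?w q * ?V q p))"
  proof (intro sum.cong refl)
    fix p assume "p \<in> ?P"
    have "(\<Sum>m | m dvd q \<and> m dvd p + a. ?c m) = ?U q p + ?V q p" for q
    proof -
      have "{m. m dvd q \<and> m dvd p + a} = {m. m dvd q \<and> coprime p m \<and> m dvd p + a} \<union>
          {m. m dvd q \<and> p dvd m \<and> m dvd p + a}"
        using \<open>p \<in> ?P\<close> prime_imp_coprime by auto
      moreover have "{m. m dvd q \<and> coprime p m \<and> m dvd p + a} \<inter>
          {m. m dvd q \<and> p dvd m \<and> m dvd p + a} = {}"
        using \<open>p \<in> ?P\<close> by (auto dest: coprime_absorb_left not_prime_unit)
      ultimately show ?thesis using a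
        by (simp only:) (intro sum.union_disjoint; auto intro: finite_subset[of _ "{m. m dvd p + a}"])
    qed
    then show "f p * g (p + a) = (\<Sum>q=1..Q. f p * (?w q * ?U q p) + f p * (?w q * ?V q p))"
      using ramanujan_expansion[OF supp sqf, of "p + a"] a
      by (simp add: sum_distrib_left distrib_left)
  qed
  also have "\<dots> = (\<Sum>p\<in>?P. \<Sum>q=1..Q. f p * (?w q * ?U q p)) + (\<Sum>p\<in>?P. f p * (\<Sum>q=1..Q. ?w q * ?V q p))"
    by (simp only: sum.distrib sum_distrib_left)
  also have "(\<Sum>p\<in>?P. \<Sum>q=1..Q. f p * (?w q * ?U q p)) = P_term f Q g N a"
  proof -
    have "(\<Sum>p\<in>?P. \<Sum>q=1..Q. f p * (?w q * ?U q p)) = (\<Sum>q=1..Q. ?w q * (\<Sum>p\<in>?P. f p * ?U q p))"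
      by (subst sum.swap) (simp add: sum_distrib_left mult_ac)
    also have "\<dots> = P_term f Q g N a"
      unfolding P_term_def
    proof (intro sum.cong refl)
      fix q assume q: "q \<in> {1..Q}"
      have "(\<Sum>p\<in>?P. f p * ?U q p) = (\<Sum>p\<in>?P. \<Sum>m | m \<in> {m. m dvd q} \<and> (coprime p m \<and> m dvd p + a). f p * ?c m)"
        by (simp add: sum_distrib_left)
      also have "\<dots> = (\<Sum>m | m dvd q. \<Sum>p | p \<in> ?P \<and> (coprime p m \<and> m dvd p + a). f p * ?c m)"
        using q fin by (intro sum.swap_restrict) auto
      also have "\<dots> = (\<Sum>m | m dvd q. ?c m *
          (\<Sum>p | prime p \<and> p \<le> N \<and> coprime p m \<and> [- int p = int a] (mod int m). f p))"
        by (simp add: sum_distrib_left cong_minus_iff_dvd conj_assoc mult_ac)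
      finally show "?w q * (\<Sum>p\<in>?P. f p * ?U q p) = ?w q * (\<Sum>m | m dvd q. ?c m *
          (\<Sum>p | prime p \<and> p \<le> N \<and> coprime p m \<and> [- int p = int a] (mod int m). f p))"
        by (simp only:)
    qed
    finally show ?thesis .
  qed
  also have "(\<Sum>p\<in>?P. f p * (\<Sum>q=1..Q. ?w q * ?V q p)) = S_term f Q g a"
  proof -
    have "(\<Sum>p\<in>?P. f p * (\<Sum>q=1..Q. ?w q * ?V q p))
        = (\<Sum>p | prime p \<and> p dvd a \<and> p \<le> Q. f p * (\<Sum>q=1..Q. ?w q * ?V q p))"
    proof (intro sum.mono_neutral_right ballI)
      fix p assume p: "p \<in> ?P - {p. prime p \<and> p dvd a \<and> p \<le> Q}"
      \<comment> \<open>A surviving \<open>m\<close> forces \<open>p dvd a\<close> (from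
        \<open>p dvd m\<close> and \<open>m dvd p + a\<close>) and \<open>p \<le> q \<le> Q\<close>
        (from \<open>m dvd q\<close>). In the other direction, \<open>Q \<le> N\<close> ensures that
        no prime divisor of \<open>a\<close> up to \<open>Q\<close> is missing from
        \<open>?P\<close>.\<close>
      have "?V q p = 0" if q: "q \<in> {1..Q}" for q
      proof -
        have "\<not> (m dvd q \<and> p dvd m \<and> m dvd p + a)" for m
        proof
          assume m: "m dvd q \<and> p dvd m \<and> m dvd p + a"
          then have "p dvd p + a" "p dvd q" using dvd_trans by blast+
          then have "p dvd a" "p \<le> q" using q by (simp_all add: dvd_imp_le)
          with p q show False by auto
        qed
        then show ?thesis by (intro sum.neutral) blast
      qed
      then show "f p * (\<Sum>q=1..Q. ?w q * ?V q p) = 0" by simp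
    qed (use fin QN in auto)
    also have "\<dots> = S_term f Q g a"
      unfolding S_term_finite[OF a]
    proof (intro sum.cong refl)
      fix p assume "p \<in> {p. prime p \<and> p dvd a \<and> p \<le> Q}"
      then have "prime p" "p dvd a" by auto
      from g_hat_prime_multiples[OF sqf this a]
      show "f p * (\<Sum>q=1..Q. ?w q * ?V q p) = f p * of_nat p *
          (\<Sum>q'=1..Q. moebius_mu q' * g_hat Q g (p * q') *
            (\<Sum>m' | m' dvd q' \<and> m' dvd a div p + 1. moebius_mu m' * of_nat m'))"
        by (simp only: mult.assoc [of "f p"])
    qed
    finally show ?thesis .
  qed
  finally show ?thesis .
qed

text \<open>Orthogonality produces the factor \<open>totient m\<close> that the denominator cancels.
  Its restriction to square-free moduli is harmless: mu(q) is 0 unless \<open>q\<close>, and with it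
  every \<open>m\<close> dividing \<open>q\<close>, is square-free.\<close>

lemma P_term_eq_P_term_chars:
  assumes sqf: "\<forall>l\<ge>1. g_hat Q g l = (moebius_mu l)\<^sup>2 * g_hat Q g l"
  shows "P_term f Q g N a = P_term_chars f Q g N a"
  unfolding P_term_def P_term_chars_def
proof (intro sum.cong refl)
  fix q assume q: "q \<in> {1..Q}"
  show "moebius_mu q * g_hat Q g q *
       (\<Sum>m | m dvd q. moebius_mu m * of_nat m *
         (\<Sum>p | prime p \<and> p \<le> N \<and> coprime p m \<and> [- int p = int a] (mod int m). f p)) =
     moebius_mu q * g_hat Q g q *
       (\<Sum>m | m dvd q. moebius_mu m * of_nat m / of_nat (totient m) *
         (\<Sum>\<chi> | dirichlet_char m \<chi>.
           \<Sum>p | prime p \<and> p \<le> N. f p * cnj (\<chi> (- int p)) * \<chi> (int a)))"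
  proof (cases "squarefree q")
    case False
    then show ?thesis by (simp add: moebius_mu_not_squarefree)
  next
    case True
    have "moebius_mu m * of_nat m *
         (\<Sum>p | prime p \<and> p \<le> N \<and> coprime p m \<and> [- int p = int a] (mod int m). f p) =
      moebius_mu m * of_nat m / of_nat (totient m) *
         (\<Sum>\<chi> | dirichlet_char m \<chi>.
           \<Sum>p | prime p \<and> p \<le> N. f p * cnj (\<chi> (- int p)) * \<chi> (int a))" if "m dvd q" for m
    proof -
      have m: "m > 0" "squarefree m" using that q True squarefree_mono by (auto intro: dvd_pos_nat)
      have "(\<Sum>\<chi> | dirichlet_char m \<chi>. \<Sum>p | prime p \<and> p \<le> N. f p * cnj (\<chi> (- int p)) * \<chi> (int a))
        = (\<Sum>p | prime p \<and> p \<le> N. f p * (\<Sum>\<chi> | dirichlet_char m \<chi>. cnj (\<chi> (- int p)) * \<chi> (int a)))"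
        by (subst sum.swap) (simp add: sum_distrib_left mult.assoc)
      also have "\<dots> = (\<Sum>p | prime p \<and> p \<le> N \<and> coprime p m \<and> [- int p = int a] (mod int m).
          of_nat (totient m) * f p)"
        unfolding dirichlet_char_orthogonality[OF m]
        by (intro sum.mono_neutral_cong_right) auto
      finally show ?thesis using m by (simp add: sum_distrib_left [symmetric])
    qed
    then have "(\<Sum>m | m dvd q. moebius_mu m * of_nat m *
        (\<Sum>p | prime p \<and> p \<le> N \<and> coprime p m \<and> [- int p = int a] (mod int m). f p)) =
      (\<Sum>m | m dvd q. moebius_mu m * of_nat m / of_nat (totient m) *
        (\<Sum>\<chi> | dirichlet_char m \<chi>.
          \<Sum>p | prime p \<and> p \<le> N. f p * cnj (\<chi> (- int p)) * \<chi> (int a)))"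
      by (intro sum.cong refl) (simp only: mem_Collect_eq)
    then show ?thesis by (simp only:)
  qed
qed

section \<open>The bound for the second term\<close>

text \<open>Replace each factor 2 by \<open>p powr \<epsilon>\<close>. This can fail only for the
  primes below \<open>B\<close>, which cost at most \<open>2 ^ B\<close> in total; the product of
  the \<open>p powr \<epsilon>\<close> is a power of the kernel of \<open>d\<close>, hence at most
  \<open>d powr \<epsilon>\<close>.\<close>

lemma two_power_card_prime_factors_bound:
  assumes "\<epsilon> > 0"
  shows "\<exists>D\<ge>0. \<forall>d\<ge>1. 2 ^ card (prime_factors d) \<le> D * real d powr \<epsilon>"
proof -
  obtain B :: nat where B: "2 powr (1 / \<epsilon>) \<le> real B" using real_arch_simple by blast
  have large: "2 \<le> real p powr \<epsilon>" if "p \<ge> B" for p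
  proof -
    have "2 = (2 powr (1 / \<epsilon>)) powr \<epsilon>" using assms by (simp add: powr_powr)
    also have "\<dots> \<le> real p powr \<epsilon>" using B that assms by (intro powr_mono2) auto
    finally show ?thesis .
  qed
  have "2 ^ card (prime_factors d) \<le> 2 ^ B * real d powr \<epsilon>" if "d \<ge> 1" for d
  proof -
    have "(2 :: real) ^ card (prime_factors d) = (\<Prod>p\<in>prime_factors d. 2)" by simp
    also have "\<dots> \<le> (\<Prod>p\<in>prime_factors d. (if p < B then 2 else 1) * real p powr \<epsilon>)"
    proof (intro prod_mono conjI)
      fix p assume "p \<in> prime_factors d"
      then have "real p \<ge> 1" using prime_ge_1_nat by auto
      then have "1 \<le> real p powr \<epsilon>" using assms by (simp add: ge_one_powr_ge_zero)
      then show "2 \<le> (if p < B then 2 else 1) * real p powr \<epsilon>" using large[of p] by auto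
    qed simp
    also have "\<dots> = 2 ^ card {p\<in>prime_factors d. p < B} * (\<Prod>p\<in>prime_factors d. real p powr \<epsilon>)"
      by (simp add: prod.distrib flip: prod.inter_filter)
    also have "(\<Prod>p\<in>prime_factors d. real p powr \<epsilon>) = real (squarefree_kernel d) powr \<epsilon>"
      by (simp add: squarefree_kernel_def prod_powr_distrib)
    also have "(2 :: real) ^ card {p\<in>prime_factors d. p < B} \<le> 2 ^ B"
      using card_mono[of "{..<B}" "{p\<in>prime_factors d. p < B}"] by (intro power_increasing) auto
    also have "real (squarefree_kernel d) powr \<epsilon> \<le> real d powr \<epsilon>"
      using squarefree_kernel_dvd[of d] that assms by (intro powr_mono2) (auto dest: dvd_imp_le)
    finally show ?thesis by (simp add: mult_right_mono)
  qed
  then show ?thesis by (intro exI[of _ "2 ^ B"]) auto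
qed

text \<open>Only \<open>t\<close> with square-free cofactor \<open>d div t\<close> contribute, and
  such a cofactor is determined by its set of primes, a subset of the primes of
  \<open>d\<close>.\<close>

lemma norm_eratosthenes_le:
  assumes d: "d \<ge> 1" and g: "\<And>t. t dvd d \<Longrightarrow> norm (g t) \<le> G"
  shows "norm (eratosthenes g d) \<le> G * 2 ^ card (prime_factors d)"
proof -
  let ?T = "{t. t dvd d \<and> squarefree (d div t)}"
  have fin: "finite {t. t dvd d}" using d by simp
  have "G \<ge> 0" using order_trans[OF norm_ge_zero g[of 1]] by simp
  have "eratosthenes g d = (\<Sum>t\<in>?T. g t * moebius_mu (d div t))"
    unfolding eratosthenes_def using fin
    by (intro sum.mono_neutral_right) (auto simp: moebius_mu_not_squarefree)
  also have "norm \<dots> \<le> (\<Sum>t\<in>?T. G)"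
    by (intro sum_norm_le) (simp add: norm_mult norm_moebius_mu g)
  also have "\<dots> = G * real (card ?T)" by simp
  also have "card ?T \<le> card (Pow (prime_factors d))"
  proof (rule card_inj_on_le)
    show "inj_on (\<lambda>t. prime_factors (d div t)) ?T"
    proof (rule inj_onI)
      fix s t assume s: "s \<in> ?T" and t: "t \<in> ?T"
        and "prime_factors (d div s) = prime_factors (d div t)"
      then have "d div s = d div t"
        by (metis (no_types, lifting) mem_Collect_eq squarefree_eq_prod_prime_factors)
      with s t d show "s = t"
        by (metis (no_types, lifting) dvd_div_eq_mult dvd_mult_div_cancel dvd_div_eq_0_iff mem_Collect_eq mult_cancel2 not_one_le_zero)
    qed
    show "(\<lambda>t. prime_factors (d div t)) ` ?T \<subseteq> Pow (prime_factors d)"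
    proof (intro image_subsetI PowI dvd_prime_factors)
      fix t assume "t \<in> ?T"
      then show "d div t dvd d" by (metis (no_types, lifting) dvd_div_mult_self dvd_triv_left mem_Collect_eq)
    qed (use d in auto)
  qed simp
  also have "card (Pow (prime_factors d)) = 2 ^ card (prime_factors d)" by (simp add: card_Pow)
  finally show ?thesis using \<open>G \<ge> 0\<close> by (simp add: mult_left_mono)
qed

text \<open>For \<open>k \<le> n\<close>, the reciprocal of \<open>k\<close> is at most
  \<open>k powr (- 1 - \<epsilon>) * n powr \<epsilon>\<close>, and the first factor is summable;
  \<open>Z\<close> is the value of that series.\<close>

lemma harmonic_sum_bound:
  assumes "\<epsilon> > 0"
  shows "\<exists>Z\<ge>0. \<forall>n\<ge>1. (\<Sum>k=1..n. 1 / real k) \<le> Z * real n powr \<epsilon>"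
proof -
  define Z where "Z = (\<Sum>k. real k powr (- 1 - \<epsilon>))"
  have sm: "summable (\<lambda>k. real k powr (- 1 - \<epsilon>))" using assms by (simp add: summable_real_powr_iff)
  have "(\<Sum>k=1..n. 1 / real k) \<le> Z * real n powr \<epsilon>" for n
  proof -
    have "(\<Sum>k=1..n. 1 / real k) \<le> (\<Sum>k=1..n. real k powr (- 1 - \<epsilon>) * real n powr \<epsilon>)"
    proof (intro sum_mono)
      fix k assume k: "k \<in> {1..n}"
      have "1 / real k = real k powr (- 1 - \<epsilon>) * real k powr \<epsilon>"
        using k by (simp add: powr_minus_divide flip: powr_add)
      also have "\<dots> \<le> real k powr (- 1 - \<epsilon>) * real n powr \<epsilon>"
        using k assms by (intro mult_left_mono powr_mono2) auto
      finally show "1 / real k \<le> real k powr (- 1 - \<epsilon>) * real n powr \<epsilon>" .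
    qed
    also have "\<dots> = (\<Sum>k=1..n. real k powr (- 1 - \<epsilon>)) * real n powr \<epsilon>"
      by (simp add: sum_distrib_right)
    also have "\<dots> \<le> Z * real n powr \<epsilon>"
      unfolding Z_def by (intro mult_right_mono sum_le_suminf sm) auto
    finally show ?thesis .
  qed
  moreover have "Z \<ge> 0" unfolding Z_def by (intro suminf_nonneg sm) simp
  ultimately show ?thesis by auto
qed

lemma sum_inverse_multiples_le:
  assumes "m \<ge> 1"
  shows "(\<Sum>d | d \<in> {1..Q} \<and> m dvd d. 1 / real d) \<le> (\<Sum>k=1..Q. 1 / real k) / real m"
proof -
  have "(\<Sum>d | d \<in> {1..Q} \<and> m dvd d. 1 / real d) \<le> (\<Sum>d\<in>(*) m ` {1..Q}. 1 / real d)"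
  proof (intro sum_mono2)
    show "{d. d \<in> {1..Q} \<and> m dvd d} \<subseteq> (*) m ` {1..Q}"
    proof
      fix d assume "d \<in> {d. d \<in> {1..Q} \<and> m dvd d}"
      then obtain k where k: "d = m * k" "1 \<le> m * k" "m * k \<le> Q" by auto
      then have "1 \<le> k" by (cases k) auto
      moreover have "k \<le> m * k" using assms by simp
      then have "k \<le> Q" using k(3) by (rule le_trans)
      ultimately have "k \<in> {1..Q}" by simp
      then show "d \<in> (*) m ` {1..Q}" using k(1) by blast
    qed
  qed auto
  also have "\<dots> = (\<Sum>k=1..Q. 1 / real k) / real m"
    using assms by (subst sum.reindex) (auto simp: inj_on_def sum_divide_distrib mult.commute)
  finally show ?thesis .
qed

lemma norm_g_hat_le:
  assumes "l \<ge> 1" and B: "\<And>d. d \<in> {1..Q} \<Longrightarrow> norm (eratosthenes g d) \<le> B" and "B \<ge> 0"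
  shows "norm (g_hat Q g l) \<le> B * (\<Sum>k=1..Q. 1 / real k) / real l"
proof -
  have "norm (g_hat Q g l) \<le> (\<Sum>d | d \<in> {1..Q} \<and> l dvd d. B * (1 / real d))"
    unfolding g_hat_def using B by (intro sum_norm_le) (auto simp: norm_divide divide_right_mono)
  also have "\<dots> = B * (\<Sum>d | d \<in> {1..Q} \<and> l dvd d. 1 / real d)" by (simp only: sum_distrib_left)
  also have "\<dots> \<le> B * ((\<Sum>k=1..Q. 1 / real k) / real l)"
    using assms by (intro mult_left_mono sum_inverse_multiples_le)
  finally show ?thesis by simp
qed

text \<open>After swapping the sums, each divisor \<open>m\<close> of \<open>b\<close> contributes
  \<open>m\<close> times the reciprocals of the multiples of \<open>m\<close>, at most one harmonic
  sum. The trivial count of at most \<open>b\<close> divisors suffices, as the final bound has room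
  for a factor \<open>a\<close>.\<close>

lemma sum_divisor_average_le:
  assumes "b \<ge> 1"
  shows "(\<Sum>q=1..Q. (\<Sum>m | m dvd q \<and> m dvd b. real m) / real q) \<le> real b * (\<Sum>k=1..Q. 1 / real k)"
proof -
  have "(\<Sum>q=1..Q. (\<Sum>m | m dvd q \<and> m dvd b. real m) / real q)
      = (\<Sum>q=1..Q. \<Sum>m | m \<in> {m. m dvd b} \<and> m dvd q. real m / real q)"
    by (simp add: sum_divide_distrib conj_commute)
  also have "\<dots> = (\<Sum>m | m dvd b. \<Sum>q | q \<in> {1..Q} \<and> m dvd q. real m / real q)"
    using assms by (intro sum.swap_restrict) auto
  also have "\<dots> = (\<Sum>m | m dvd b. real m * (\<Sum>q | q \<in> {1..Q} \<and> m dvd q. 1 / real q))"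
    by (simp add: sum_distrib_left)
  also have "\<dots> \<le> (\<Sum>m | m dvd b. \<Sum>k=1..Q. 1 / real k)"
  proof (intro sum_mono)
    fix m assume "m \<in> {m. m dvd b}"
    then have "m \<ge> 1" using assms by (auto intro!: Suc_leI Nat.gr0I)
    with sum_inverse_multiples_le[OF this, of Q]
    show "real m * (\<Sum>q | q \<in> {1..Q} \<and> m dvd q. 1 / real q) \<le> (\<Sum>k=1..Q. 1 / real k)"
      by (simp add: field_simps)
  qed
  also have "\<dots> = real (card {m. m dvd b}) * (\<Sum>k=1..Q. 1 / real k)" by simp
  also have "\<dots> \<le> real b * (\<Sum>k=1..Q. 1 / real k)"
  proof (intro mult_right_mono)
    have "{m. m dvd b} \<subseteq> {1..b}" using assms by (auto dest: dvd_imp_le intro!: Suc_leI Nat.gr0I)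
    then show "real (card {m. m dvd b}) \<le> real b" using card_mono[of "{1..b}"] by fastforce
  qed (auto intro: sum_nonneg)
  finally show ?thesis .
qed

text \<open>The three harmonic sums come from the bound on \<open>g_hat\<close>, from the average
  over \<open>q'\<close>, and from the sum of 1/p over \<open>p\<close>. The explicit factor
  \<open>p\<close> in \<open>S_term\<close> cancels the 1/p in the bound for
  \<open>g_hat Q g (p * q')\<close>; the remaining 1/p comes from
  \<open>a div p + 1\<close>.\<close>

lemma norm_S_term_le:
  assumes a: "a \<ge> 1"
    and f: "\<And>p. prime p \<Longrightarrow> p \<le> Q \<Longrightarrow> norm (f p) \<le> F" and "F \<ge> 0"
    and g: "\<And>d. d \<in> {1..Q} \<Longrightarrow> norm (eratosthenes g d) \<le> B" and "B \<ge> 0"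
  shows "norm (S_term f Q g a) \<le> 2 * F * B * (\<Sum>k=1..Q. 1 / real k) ^ 3 * real a"
proof -
  define H where "H = (\<Sum>k=1..Q. 1 / real k)"
  have "H \<ge> 0" unfolding H_def by (intro sum_nonneg) simp
  let ?c = "\<lambda>q b. \<Sum>m | m dvd q \<and> m dvd b. moebius_mu m * of_nat m :: complex"
  have inner: "norm (\<Sum>q=1..Q. moebius_mu q * g_hat Q g (p * q) * ?c q b) \<le> B * H / real p * (real b * H)"
    if "p \<ge> 1" "b \<ge> 1" for p b
  proof -
    have "norm (\<Sum>q=1..Q. moebius_mu q * g_hat Q g (p * q) * ?c q b)
        \<le> (\<Sum>q=1..Q. B * H / real p * ((\<Sum>m | m dvd q \<and> m dvd b. real m) / real q))"
    proof (intro sum_norm_le)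
      fix q assume q: "q \<in> {1..Q}"
      have "norm (g_hat Q g (p * q)) \<le> B * H / real (p * q)"
        unfolding H_def using that q g \<open>B \<ge> 0\<close> by (intro norm_g_hat_le) auto
      moreover have "norm (?c q b) \<le> (\<Sum>m | m dvd q \<and> m dvd b. real m)"
        by (intro sum_norm_le) (simp add: norm_mult mult_left_le_one_le norm_moebius_mu_le)
      ultimately have "norm (moebius_mu q * g_hat Q g (p * q) * ?c q b)
          \<le> 1 * (B * H / real (p * q)) * (\<Sum>m | m dvd q \<and> m dvd b. real m)"
        unfolding norm_mult using norm_moebius_mu_le \<open>B \<ge> 0\<close> \<open>H \<ge> 0\<close>
        by (intro mult_mono) auto
      then show "norm (moebius_mu q * g_hat Q g (p * q) * ?c q b)
          \<le> B * H / real p * ((\<Sum>m | m dvd q \<and> m dvd b. real m) / real q)"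
        by simp
    qed
    also have "\<dots> = B * H / real p * (\<Sum>q=1..Q. (\<Sum>m | m dvd q \<and> m dvd b. real m) / real q)"
      by (simp only: sum_distrib_left)
    also have "\<dots> \<le> B * H / real p * (real b * H)"
      unfolding H_def using that \<open>B \<ge> 0\<close> \<open>H \<ge> 0\<close>
      by (intro mult_left_mono sum_divisor_average_le) (auto simp: H_def)
    finally show ?thesis .
  qed
  have "norm (S_term f Q g a) \<le> (\<Sum>p | prime p \<and> p dvd a \<and> p \<le> Q. 2 * F * B * H\<^sup>2 * real a * (1 / real p))"
    unfolding S_term_finite[OF order_less_le_trans[OF zero_less_one a]]
  proof (intro sum_norm_le)
    fix p assume "p \<in> {p. prime p \<and> p dvd a \<and> p \<le> Q}"
    then have p: "prime p" "p dvd a" "p \<le> Q" "p \<ge> 1" using prime_ge_1_nat by auto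
    then have "p \<le> a" using a by (simp add: dvd_imp_le)
    \<comment> \<open>As \<open>p \<le> a\<close>, the summand 1 is at most a/p, which is the source
      of the constant 2.\<close>
    have b: "real (a div p + 1) \<le> 2 * real a / real p"
      using p \<open>p \<le> a\<close> by (simp add: real_of_nat_div field_simps)
    have "norm (f p * of_nat p *
        (\<Sum>q=1..Q. moebius_mu q * g_hat Q g (p * q) * ?c q (a div p + 1)))
        \<le> F * real p * (B * H / real p * (real (a div p + 1) * H))"
      unfolding norm_mult norm_of_nat using p f \<open>F \<ge> 0\<close>
      by (intro mult_mono inner mult_right_mono) auto
    also have "\<dots> = F * B * H\<^sup>2 * real (a div p + 1)"
      using p by (simp add: power2_eq_square)
    also have "\<dots> \<le> F * B * H\<^sup>2 * (2 * real a / real p)"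
      using b \<open>F \<ge> 0\<close> \<open>B \<ge> 0\<close> by (intro mult_left_mono) auto
    finally show "norm (f p * of_nat p *
        (\<Sum>q=1..Q. moebius_mu q * g_hat Q g (p * q) * ?c q (a div p + 1)))
        \<le> 2 * F * B * H\<^sup>2 * real a * (1 / real p)" by (simp add: mult_ac)
  qed
  also have "\<dots> = 2 * F * B * H\<^sup>2 * real a * (\<Sum>p | prime p \<and> p dvd a \<and> p \<le> Q. 1 / real p)"
    by (simp only: sum_distrib_left)
  also have "\<dots> \<le> 2 * F * B * H\<^sup>2 * real a * H"
    unfolding H_def using \<open>F \<ge> 0\<close> \<open>B \<ge> 0\<close>
    by (intro mult_left_mono sum_mono2) (auto simp: prime_gt_0_nat Suc_leI)
  also have "\<dots> = 2 * F * B * H ^ 3 * real a" by (simp add: power2_eq_square power3_eq_cube)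
  finally show ?thesis by (simp only: H_def)
qed

lemma S_term_uniform_bound:
  fixes Cf Cg :: "real \<Rightarrow> real"
  assumes "\<epsilon> > 0"
  shows "\<exists>K. \<forall>N Q f g. Q \<le> N \<and> ramanujan_bound Cf f \<and> ramanujan_bound Cg g \<longrightarrow>
    (\<forall>a\<ge>1. norm (S_term f Q g a) \<le> K * real N powr \<epsilon> * real a)"
proof -
  \<comment> \<open>Six factors \<open>N powr \<delta>\<close> will occur: one from
    \<open>f\<close>, two from the transform of \<open>g\<close> (its values and the count of
    cofactors), and three from the harmonic sums.\<close>
  define \<delta> where "\<delta> = \<epsilon> / 6"
  have "\<delta> > 0" using assms by (simp add: \<delta>_def)
  obtain D where D: "D \<ge> 0" "\<And>d. d \<ge> 1 \<Longrightarrow> 2 ^ card (prime_factors d) \<le> D * real d powr \<delta>"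
    using two_power_card_prime_factors_bound[OF \<open>\<delta> > 0\<close>] by blast
  obtain Z where Z: "Z \<ge> 0" "\<And>n. n \<ge> 1 \<Longrightarrow> (\<Sum>k=1..n. 1 / real k) \<le> Z * real n powr \<delta>"
    using harmonic_sum_bound[OF \<open>\<delta> > 0\<close>] by blast
  \<comment> \<open>\<open>?K\<close> is fixed before \<open>N\<close>, \<open>Q\<close>,
    \<open>f\<close> and \<open>g\<close>. The absolute values make it nonnegative without a sign
    condition on \<open>Cf\<close> and \<open>Cg\<close>.\<close>
  let ?K = "2 * \<bar>Cf \<delta>\<bar> * (\<bar>Cg \<delta>\<bar> * D) * Z ^ 3"
  have "norm (S_term f Q g a) \<le> ?K * real N powr \<epsilon> * real a"
    if QN: "Q \<le> N" and f: "ramanujan_bound Cf f" and g: "ramanujan_bound Cg g" and a: "a \<ge> 1"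
    for N Q f g a
  proof -
    let ?P = "real N powr \<delta>"
    have bound: "norm (h n) \<le> \<bar>C \<delta>\<bar> * ?P" if "ramanujan_bound C h" "n \<ge> 1" "n \<le> N" for C h n
    proof -
      have "norm (h n) \<le> C \<delta> * real n powr \<delta>"
        using that \<open>\<delta> > 0\<close> by (simp add: ramanujan_bound_def)
      also have "\<dots> \<le> \<bar>C \<delta>\<bar> * ?P"
        using that \<open>\<delta> > 0\<close> by (intro mult_mono powr_mono2) auto
      finally show ?thesis .
    qed
    have era: "norm (eratosthenes g d) \<le> \<bar>Cg \<delta>\<bar> * D * ?P ^ 2" if d: "d \<in> {1..Q}" for d
    proof -
      have "norm (eratosthenes g d) \<le> \<bar>Cg \<delta>\<bar> * ?P * 2 ^ card (prime_factors d)"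
      proof (rule norm_eratosthenes_le)
        fix t assume "t dvd d"
        then have "t \<ge> 1" "t \<le> d" using d by (auto intro!: Suc_leI Nat.gr0I dvd_imp_le)
        then show "norm (g t) \<le> \<bar>Cg \<delta>\<bar> * ?P" using d QN by (intro bound[OF g]) auto
      qed (use d in auto)
      also have "\<dots> \<le> \<bar>Cg \<delta>\<bar> * ?P * (D * ?P)"
      proof (intro mult_left_mono)
        have "2 ^ card (prime_factors d) \<le> D * real d powr \<delta>" using D(2) d by simp
        also have "\<dots> \<le> D * ?P" using d QN D(1) \<open>\<delta> > 0\<close> by (intro mult_left_mono powr_mono2) auto
        finally show "2 ^ card (prime_factors d) \<le> D * ?P" .
      qed simp
      finally show ?thesis by (simp add: power2_eq_square mult_ac)
    qed
    have H: "(\<Sum>k=1..Q. 1 / real k) \<le> Z * ?P"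
    proof (cases "Q = 0")
      case False
      then have "(\<Sum>k=1..Q. 1 / real k) \<le> Z * real Q powr \<delta>" using Z(2) by simp
      also have "\<dots> \<le> Z * ?P" using QN Z(1) \<open>\<delta> > 0\<close> by (intro mult_left_mono powr_mono2) auto
      finally show ?thesis .
    qed (use Z in simp)
    have "norm (S_term f Q g a)
        \<le> 2 * (\<bar>Cf \<delta>\<bar> * ?P) * (\<bar>Cg \<delta>\<bar> * D * ?P ^ 2) * (\<Sum>k=1..Q. 1 / real k) ^ 3 * real a"
    proof (rule norm_S_term_le[OF a])
      show "norm (f p) \<le> \<bar>Cf \<delta>\<bar> * ?P" if "prime p" "p \<le> Q" for p
        using that QN prime_ge_1_nat[of p] by (intro bound[OF f]) auto
    qed (use era D in auto)
    also have "\<dots> \<le> 2 * (\<bar>Cf \<delta>\<bar> * ?P) * (\<bar>Cg \<delta>\<bar> * D * ?P ^ 2) * (Z * ?P) ^ 3 * real a"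
      using H D(1) by (intro mult_left_mono mult_right_mono power_mono sum_nonneg) auto
    also have "\<dots> = ?K * ?P ^ 6 * real a" by (simp add: eval_nat_numeral mult_ac)
    also have "?P ^ 6 = real N powr \<epsilon>"
      using powr_realpow'[of ?P 6] by (simp add: powr_powr \<delta>_def)
    finally show ?thesis .
  qed
  then show ?thesis by blast
qed

text \<open>The bound is a conjunct of its own so that \<open>K\<close> can be chosen before
  \<open>N\<close>, \<open>Q\<close>, \<open>f\<close>, \<open>g\<close> and \<open>a\<close>: the
  implied constant depends only on \<open>\<epsilon>\<close> and on the constants in the Ramanujan
  Conjecture for \<open>f\<close> and \<open>g\<close>.\<close>

theorem theorem3p2:
  shows
    "(\<forall>(N::nat) (Q::nat) (f :: nat \<Rightarrow> complex) (g :: nat \<Rightarrow> complex).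
        1 \<le> Q \<and> Q \<le> N \<and> (\<forall>d. d \<notin> {1..Q} \<longrightarrow> eratosthenes g d = 0) \<longrightarrow>
        ((\<forall>l\<ge>1. g_hat Q g l = (moebius_mu l)\<^sup>2 * g_hat Q g l) \<longleftrightarrow>
         (\<forall>a\<ge>1. g a = g (squarefree_kernel a))) \<and>
        ((\<forall>l\<ge>1. g_hat Q g l = (moebius_mu l)\<^sup>2 * g_hat Q g l) \<and>
         (\<forall>n\<ge>1. \<not> prime n \<longrightarrow> f n = 0) \<and>
         ramanujan_conjecture f \<and> ramanujan_conjecture g \<longrightarrow>
         (\<forall>a\<ge>1. correlation f g N a = P_term f Q g N a + S_term f Q g a \<and>
                P_term f Q g N a = P_term_chars f Q g N a)))
   \<and>
     (\<forall>(Cf :: real \<Rightarrow> real) (Cg :: real \<Rightarrow> real) (\<epsilon>::real). \<epsilon> > 0 \<longrightarrow>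
        (\<exists>K::real. \<forall>(N::nat) (Q::nat) (f :: nat \<Rightarrow> complex) (g :: nat \<Rightarrow> complex).
           1 \<le> Q \<and> Q \<le> N \<and> (\<forall>d. d \<notin> {1..Q} \<longrightarrow> eratosthenes g d = 0) \<and>
           (\<forall>l\<ge>1. g_hat Q g l = (moebius_mu l)\<^sup>2 * g_hat Q g l) \<and>
           (\<forall>n\<ge>1. \<not> prime n \<longrightarrow> f n = 0) \<and>
           ramanujan_bound Cf f \<and> ramanujan_bound Cg g \<longrightarrow>
           (\<forall>a\<ge>1. norm (S_term f Q g a) \<le> K * real N powr \<epsilon> * real a)))"
proof (intro conjI allI impI)
  fix N Q :: nat and f g :: "nat \<Rightarrow> complex"
  assume *: "1 \<le> Q \<and> Q \<le> N \<and> (\<forall>d. d \<notin> {1..Q} \<longrightarrow> eratosthenes g d = 0)"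
  then show "(\<forall>l\<ge>1. g_hat Q g l = (moebius_mu l)\<^sup>2 * g_hat Q g l) \<longleftrightarrow>
      (\<forall>a\<ge>1. g a = g (squarefree_kernel a))"
    using g_hat_squarefree_iff_eratosthenes_squarefree kernel_invariant_iff_eratosthenes_squarefree
    by blast
  fix a :: nat
  assume sqf: "(\<forall>l\<ge>1. g_hat Q g l = (moebius_mu l)\<^sup>2 * g_hat Q g l) \<and>
      (\<forall>n\<ge>1. \<not> prime n \<longrightarrow> f n = 0) \<and> ramanujan_conjecture f \<and> ramanujan_conjecture g"
    and "a \<ge> 1"
  with * show "correlation f g N a = P_term f Q g N a + S_term f Q g a"
    by (intro correlation_eq_P_term_plus_S_term) auto
  from sqf show "P_term f Q g N a = P_term_chars f Q g N a"
    by (intro P_term_eq_P_term_chars) blast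
next
  fix Cf Cg :: "real \<Rightarrow> real" and \<epsilon> :: real
  assume "\<epsilon> > 0"
  then obtain K where K: "norm (S_term f Q g a) \<le> K * real N powr \<epsilon> * real a"
    if "Q \<le> N" "ramanujan_bound Cf f" "ramanujan_bound Cg g" "a \<ge> 1" for N Q f g a
    using S_term_uniform_bound[of \<epsilon> Cf Cg] by blast
  show "\<exists>K. \<forall>N Q f g.
      1 \<le> Q \<and> Q \<le> N \<and> (\<forall>d. d \<notin> {1..Q} \<longrightarrow> eratosthenes g d = 0) \<and>
      (\<forall>l\<ge>1. g_hat Q g l = (moebius_mu l)\<^sup>2 * g_hat Q g l) \<and>
      (\<forall>n\<ge>1. \<not> prime n \<longrightarrow> f n = 0) \<and>
      ramanujan_bound Cf f \<and> ramanujan_bound Cg g \<longrightarrow>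
      (\<forall>a\<ge>1. norm (S_term f Q g a) \<le> K * real N powr \<epsilon> * real a)"
    by (intro exI[of _ K] allI impI, elim conjE) (rule K; assumption)
qed

end
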